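(* There exists a maximal cofinitary group $G \le S_\infty$ which is arithmetical: there is $n\in\mathbb N$ such that $G$, viewed as a subset of Baire space ${}^{\mathbb N}\mathbb N$, is definable by a parameter-free $\Sigma^0_n$ formula of second-order arithmetic (a formula whose only quantifiers range over natural numbers). In particular $G$ is a Borel set of finite Borel rank.
   Context: $S_\infty$ denotes the group of all bijections $\mathbb N\to\mathbb N$, regarded as a subset of Baire space ${}^{\mathbb N}\mathbb N$. A subgroup $G\le S_\infty$ is cofinitary if every non-identity element of $G$ has only finitely many fixed points. A cofinitary group is maximal cofinitary if it is not a proper subgroup of any cofinitary subgroup of $S_\infty$. *)

theory Defs
  imports "HOL-Analysis.Analysis" "HOL-Algebra.Bij"
begin

definition cofinitary_group :: "(nat \<Rightarrow> nat) set \<Rightarrow> bool" where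
  "cofinitary_group G \<longleftrightarrow> subgroup G (BijGroup (UNIV :: nat set)) \<and>
     (\<forall>g\<in>G. g \<noteq> id \<longrightarrow> finite {n. g n = n})"

definition maximal_cofinitary_group :: "(nat \<Rightarrow> nat) set \<Rightarrow> bool" where
  "maximal_cofinitary_group G \<longleftrightarrow> cofinitary_group G \<and>
     \<not> (\<exists>H. cofinitary_group H \<and> G \<subset> H)"

text \<open>Number variables are de Bruijn indices; the single function symbol
  Fn stands for the (free) element of Baire space being tested.\<close>

datatype aterm = Var nat | Zero | Succ aterm | Plus aterm aterm | Times aterm aterm
  | Fn aterm

datatype aform = Eq aterm aterm | Less aterm aterm | Neg aform | Conj aform aform
  | Disj aform aform
  | BEx aterm aform
  | BAll aterm aform
  | Ex aform | All aform

primrec teval :: "(nat \<Rightarrow> nat) \<Rightarrow> (nat \<Rightarrow> nat) \<Rightarrow> aterm \<Rightarrow> nat" where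
  "teval f e (Var i) = e i"
| "teval f e Zero = 0"
| "teval f e (Succ t) = Suc (teval f e t)"
| "teval f e (Plus s t) = teval f e s + teval f e t"
| "teval f e (Times s t) = teval f e s * teval f e t"
| "teval f e (Fn t) = f (teval f e t)"

primrec sat :: "(nat \<Rightarrow> nat) \<Rightarrow> (nat \<Rightarrow> nat) \<Rightarrow> aform \<Rightarrow> bool" where
  "sat f e (Eq s t) = (teval f e s = teval f e t)"
| "sat f e (Less s t) = (teval f e s < teval f e t)"
| "sat f e (Neg p) = (\<not> sat f e p)"
| "sat f e (Conj p q) = (sat f e p \<and> sat f e q)"
| "sat f e (Disj p q) = (sat f e p \<or> sat f e q)"
| "sat f e (BEx t p) = (\<exists>x < teval f e t. sat f (case_nat x e) p)"
| "sat f e (BAll t p) = (\<forall>x < teval f e t. sat f (case_nat x e) p)"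
| "sat f e (Ex p) = (\<exists>x. sat f (case_nat x e) p)"
| "sat f e (All p) = (\<forall>x. sat f (case_nat x e) p)"

primrec tclosed :: "nat \<Rightarrow> aterm \<Rightarrow> bool" where
  "tclosed k (Var i) = (i < k)"
| "tclosed k Zero = True"
| "tclosed k (Succ t) = tclosed k t"
| "tclosed k (Plus s t) = (tclosed k s \<and> tclosed k t)"
| "tclosed k (Times s t) = (tclosed k s \<and> tclosed k t)"
| "tclosed k (Fn t) = tclosed k t"

primrec fclosed :: "nat \<Rightarrow> aform \<Rightarrow> bool" where
  "fclosed k (Eq s t) = (tclosed k s \<and> tclosed k t)"
| "fclosed k (Less s t) = (tclosed k s \<and> tclosed k t)"
| "fclosed k (Neg p) = fclosed k p"
| "fclosed k (Conj p q) = (fclosed k p \<and> fclosed k q)"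
| "fclosed k (Disj p q) = (fclosed k p \<and> fclosed k q)"
| "fclosed k (BEx t p) = (tclosed k t \<and> fclosed (Suc k) p)"
| "fclosed k (BAll t p) = (tclosed k t \<and> fclosed (Suc k) p)"
| "fclosed k (Ex p) = fclosed (Suc k) p"
| "fclosed k (All p) = fclosed (Suc k) p"

primrec bounded_form :: "aform \<Rightarrow> bool" where
  "bounded_form (Eq s t) = True"
| "bounded_form (Less s t) = True"
| "bounded_form (Neg p) = bounded_form p"
| "bounded_form (Conj p q) = (bounded_form p \<and> bounded_form q)"
| "bounded_form (Disj p q) = (bounded_form p \<and> bounded_form q)"
| "bounded_form (BEx t p) = bounded_form p"
| "bounded_form (BAll t p) = bounded_form p"
| "bounded_form (Ex p) = False"
| "bounded_form (All p) = False"

inductive Sigma_form :: "nat \<Rightarrow> aform \<Rightarrow> bool" and Pi_form :: "nat \<Rightarrow> aform \<Rightarrow> bool" where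
  Sigma0: "bounded_form p \<Longrightarrow> Sigma_form 0 p"
| Pi0: "bounded_form p \<Longrightarrow> Pi_form 0 p"
| Sigma_Pi: "Pi_form n p \<Longrightarrow> Sigma_form (Suc n) p"
| Sigma_Ex: "Sigma_form (Suc n) p \<Longrightarrow> Sigma_form (Suc n) (Ex p)"
| Pi_Sigma: "Sigma_form n p \<Longrightarrow> Pi_form (Suc n) p"
| Pi_All: "Pi_form (Suc n) p \<Longrightarrow> Pi_form (Suc n) (All p)"

definition defines_set :: "aform \<Rightarrow> (nat \<Rightarrow> nat) set \<Rightarrow> bool" where
  "defines_set p A \<longleftrightarrow> fclosed 0 p \<and> A = {f. sat f (\<lambda>_. 0) p}"

definition Sigma0_definable :: "nat \<Rightarrow> (nat \<Rightarrow> nat) set \<Rightarrow> bool" where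
  "Sigma0_definable n A \<longleftrightarrow> (\<exists>p. Sigma_form n p \<and> defines_set p A)"

end

theory Submission
  imports Defs "HOL-Library.Nat_Bijection" "HOL-Number_Theory.Cong" "HOL-Combinatorics.Permutations"
begin

text \<open>The group is generated by involutions, one for each set \<open>\<xi>\<close> of natural numbers. The natural numbers are
  partitioned into finite blocks, and initially \<open>\<xi>\<close> acts on the \<open>n\<close>-th block by a fixed-point-free involution
  that depends only on \<open>\<xi> \<inter> {..<n}\<close>; on that block, no reduced word of length at most \<open>n\<close> has a fixed point.
  If \<open>\<xi>\<close> codes a permutation \<open>x\<close>, the generator of \<open>\<xi>\<close> is then altered on a sparse set so that it agrees with
  \<open>x\<close> infinitely often, unless \<open>x\<close> already agrees infinitely often with a word in the initial generators and
  hence also with the same word in the altered ones. In either case \<open>x\<close> cannot be added to the group without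
  destroying cofinitarity. The alterations are arranged in such a way that those occurring in a fixed word
  connect distant blocks in the manner of a forest, so that no short cycles arise. All choices are arithmetical,
  and the letters of a word can be read off from its values on large blocks.\<close>

section \<open>Arithmetical predicates\<close>

text \<open>Maximal cofinitary groups usually come from a transfinite recursion through all
  permutations, which gives no simple definition. Here each permutation is treated by the generator
  that carries its code, without knowledge of the others, so interference has to be excluded in
  advance: two sets code few common blocks, and a fixed order of the blocks takes the place of the
  order of the recursion. Agreement of a permutation with a word cannot be tested word by word,
  since the letters are infinite sets. Inside one block a letter is one of finitely many
  truncations; counting finds a finite word shared by many points, and a leftmost limit over the
  blocks turns these finite words into a word of sets. Membership in the group meets the same
  difficulty, because "there is a word" quantifies over sets; the quantifier disappears since the
  same limit computes the word from its value. Generators of order two avoid exponents: reduced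
  means that neighbouring letters differ, and the inverse of a word is its reversal.\<close>

primrec ren_term :: "(nat \<Rightarrow> nat) \<Rightarrow> aterm \<Rightarrow> aterm" where
  "ren_term r (Var i) = Var (r i)"
| "ren_term r Zero = Zero"
| "ren_term r (Succ t) = Succ (ren_term r t)"
| "ren_term r (Plus s t) = Plus (ren_term r s) (ren_term r t)"
| "ren_term r (Times s t) = Times (ren_term r s) (ren_term r t)"
| "ren_term r (Fn t) = Fn (ren_term r t)"

abbreviation lift_ren :: "(nat \<Rightarrow> nat) \<Rightarrow> nat \<Rightarrow> nat" where
  "lift_ren r \<equiv> case_nat 0 (\<lambda>i. Suc (r i))"

primrec ren_form :: "(nat \<Rightarrow> nat) \<Rightarrow> aform \<Rightarrow> aform" where
  "ren_form r (Eq s t) = Eq (ren_term r s) (ren_term r t)"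
| "ren_form r (Less s t) = Less (ren_term r s) (ren_term r t)"
| "ren_form r (Neg p) = Neg (ren_form r p)"
| "ren_form r (Conj p q) = Conj (ren_form r p) (ren_form r q)"
| "ren_form r (Disj p q) = Disj (ren_form r p) (ren_form r q)"
| "ren_form r (BEx t p) = BEx (ren_term r t) (ren_form (lift_ren r) p)"
| "ren_form r (BAll t p) = BAll (ren_term r t) (ren_form (lift_ren r) p)"
| "ren_form r (Ex p) = Ex (ren_form (lift_ren r) p)"
| "ren_form r (All p) = All (ren_form (lift_ren r) p)"

lemma teval_ren: "teval f e (ren_term r t) = teval f (\<lambda>i. e (r i)) t"
  by (induction t) auto

lemma case_nat_lift_ren: "(\<lambda>i. case_nat x e (lift_ren r i)) = case_nat x (\<lambda>i. e (r i))"
  by (auto simp: fun_eq_iff split: nat.split)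

lemma sat_ren: "sat f e (ren_form r p) = sat f (\<lambda>i. e (r i)) p"
  by (induction p arbitrary: e r) (simp_all add: teval_ren case_nat_lift_ren)

lemma tclosed_ren: "tclosed k t \<Longrightarrow> (\<And>i. i < k \<Longrightarrow> r i < k') \<Longrightarrow> tclosed k' (ren_term r t)"
  by (induction t) auto

lemma fclosed_ren: "fclosed k p \<Longrightarrow> (\<And>i. i < k \<Longrightarrow> r i < k') \<Longrightarrow> fclosed k' (ren_form r p)"
proof (induction p arbitrary: k k' r)
  case (BEx t p)
  have "fclosed (Suc k') (ren_form (lift_ren r) p)"
    using BEx.prems by (intro BEx.IH[where k="Suc k"]) (auto split: nat.split)
  then show ?case using BEx.prems by (auto intro: tclosed_ren)
next
  case (BAll t p)
  have "fclosed (Suc k') (ren_form (lift_ren r) p)"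
    using BAll.prems by (intro BAll.IH[where k="Suc k"]) (auto split: nat.split)
  then show ?case using BAll.prems by (auto intro: tclosed_ren)
next
  case (Ex p)
  have "fclosed (Suc k') (ren_form (lift_ren r) p)"
    using Ex.prems by (intro Ex.IH[where k="Suc k"]) (auto split: nat.split)
  then show ?case by simp
next
  case (All p)
  have "fclosed (Suc k') (ren_form (lift_ren r) p)"
    using All.prems by (intro All.IH[where k="Suc k"]) (auto split: nat.split)
  then show ?case by simp
qed (auto intro: tclosed_ren)

lemma bounded_ren: "bounded_form (ren_form r p) = bounded_form p"
  by (induction p arbitrary: r) auto

lemma tclosed_mono: "tclosed k t \<Longrightarrow> k \<le> k' \<Longrightarrow> tclosed k' t"
  by (induction t) auto

lemma fclosed_mono: "fclosed k p \<Longrightarrow> k \<le> k' \<Longrightarrow> fclosed k' p"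
proof (induction p arbitrary: k k')
  case (BEx t p)
  then have "fclosed (Suc k') p" by (metis Suc_le_mono fclosed.simps(6))
  then show ?case using BEx.prems by (auto intro: tclosed_mono)
next
  case (BAll t p)
  then have "fclosed (Suc k') p" by (metis Suc_le_mono fclosed.simps(7))
  then show ?case using BAll.prems by (auto intro: tclosed_mono)
next
  case (Ex p)
  then show ?case by (metis Suc_le_mono fclosed.simps(8))
next
  case (All p)
  then show ?case by (metis Suc_le_mono fclosed.simps(9))
qed (auto intro: tclosed_mono)

section \<open>Prenex normal forms\<close>

lemma ren_Sigma_Pi:
  "Sigma_form n p \<Longrightarrow> Sigma_form n (ren_form r p)"
  "Pi_form n p \<Longrightarrow> Pi_form n (ren_form r p)"
proof (induction arbitrary: r and r rule: Sigma_form_Pi_form.inducts)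
qed (auto intro: Sigma_form_Pi_form.intros simp: bounded_ren)

lemma Sigma_Pi_Suc:
  "Sigma_form n p \<Longrightarrow> Sigma_form (Suc n) p"
  "Pi_form n p \<Longrightarrow> Pi_form (Suc n) p"
proof (induction rule: Sigma_form_Pi_form.inducts)
qed (auto intro: Sigma_form_Pi_form.intros)

lemma Neg_Sigma_Pi:
  "Sigma_form n p \<Longrightarrow> \<exists>q. Pi_form n q \<and> (\<forall>k. fclosed k p \<longrightarrow> fclosed k q) \<and> (\<forall>f e. sat f e q \<longleftrightarrow> \<not> sat f e p)"
  "Pi_form n p \<Longrightarrow> \<exists>q. Sigma_form n q \<and> (\<forall>k. fclosed k p \<longrightarrow> fclosed k q) \<and> (\<forall>f e. sat f e q \<longleftrightarrow> \<not> sat f e p)"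
proof (induction rule: Sigma_form_Pi_form.inducts)
  case (Sigma0 p)
  then show ?case by (intro exI[of _ "Neg p"]) (auto intro: Sigma_form_Pi_form.intros)
next
  case (Pi0 p)
  then show ?case by (intro exI[of _ "Neg p"]) (auto intro: Sigma_form_Pi_form.intros)
next
  case (Sigma_Ex n p)
  then obtain q where "Pi_form (Suc n) q" "\<forall>k. fclosed k p \<longrightarrow> fclosed k q" "\<forall>f e. sat f e q \<longleftrightarrow> \<not> sat f e p"
    by blast
  then show ?case by (intro exI[of _ "All q"]) (auto intro: Sigma_form_Pi_form.intros)
next
  case (Pi_All n p)
  then obtain q where "Sigma_form (Suc n) q" "\<forall>k. fclosed k p \<longrightarrow> fclosed k q" "\<forall>f e. sat f e q \<longleftrightarrow> \<not> sat f e p"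
    by blast
  then show ?case by (intro exI[of _ "Ex q"]) (auto intro: Sigma_form_Pi_form.intros)
qed (blast intro: Sigma_form_Pi_form.intros)+

text \<open>This is the second half of the conjunction of two prenex formulas: once the quantifiers
  of one factor have been pulled out, that factor is bounded and is carried under the quantifiers of
  the other by shifting its variables.\<close>

lemma Conj_bounded_Sigma_Pi:
  "Sigma_form n p \<Longrightarrow> bounded_form b \<Longrightarrow> \<exists>q. Sigma_form n q \<and>
     (\<forall>k. fclosed k p \<and> fclosed k b \<longrightarrow> fclosed k q) \<and> (\<forall>f e. sat f e q \<longleftrightarrow> sat f e p \<and> sat f e b)"
  "Pi_form n p \<Longrightarrow> bounded_form b \<Longrightarrow> \<exists>q. Pi_form n q \<and>
     (\<forall>k. fclosed k p \<and> fclosed k b \<longrightarrow> fclosed k q) \<and> (\<forall>f e. sat f e q \<longleftrightarrow> sat f e p \<and> sat f e b)"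
proof (induction arbitrary: b and b rule: Sigma_form_Pi_form.inducts)
  case (Sigma0 p)
  then show ?case by (intro exI[of _ "Conj p b"]) (auto intro: Sigma_form_Pi_form.intros)
next
  case (Pi0 p)
  then show ?case by (intro exI[of _ "Conj p b"]) (auto intro: Sigma_form_Pi_form.intros)
next
  case (Sigma_Ex n p)
  have "bounded_form (ren_form Suc b)" using Sigma_Ex.prems by (simp add: bounded_ren)
  from Sigma_Ex.IH[OF this] obtain q where q: "Sigma_form (Suc n) q"
    "\<forall>k. fclosed k p \<and> fclosed k (ren_form Suc b) \<longrightarrow> fclosed k q"
    "\<forall>f e. sat f e q \<longleftrightarrow> sat f e p \<and> sat f e (ren_form Suc b)" by blast
  have "fclosed k b \<Longrightarrow> fclosed (Suc k) (ren_form Suc b)" for k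
    by (rule fclosed_ren) auto
  then show ?case using q by (intro exI[of _ "Ex q"]) (auto intro: Sigma_form_Pi_form.intros simp: sat_ren)
next
  case (Pi_All n p)
  have "bounded_form (ren_form Suc b)" using Pi_All.prems by (simp add: bounded_ren)
  from Pi_All.IH[OF this] obtain q where q: "Pi_form (Suc n) q"
    "\<forall>k. fclosed k p \<and> fclosed k (ren_form Suc b) \<longrightarrow> fclosed k q"
    "\<forall>f e. sat f e q \<longleftrightarrow> sat f e p \<and> sat f e (ren_form Suc b)" by blast
  have "fclosed k b \<Longrightarrow> fclosed (Suc k) (ren_form Suc b)" for k
    by (rule fclosed_ren) auto
  then show ?case using q by (intro exI[of _ "All q"]) (auto intro: Sigma_form_Pi_form.intros simp: sat_ren)
next
  case (Sigma_Pi n p)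
  then obtain q where "Pi_form n q" "\<forall>k. fclosed k p \<and> fclosed k b \<longrightarrow> fclosed k q"
    "\<forall>f e. sat f e q \<longleftrightarrow> sat f e p \<and> sat f e b" by metis
  then show ?case using Sigma_form_Pi_form.Sigma_Pi by blast
next
  case (Pi_Sigma n p)
  then obtain q where "Sigma_form n q" "\<forall>k. fclosed k p \<and> fclosed k b \<longrightarrow> fclosed k q"
    "\<forall>f e. sat f e q \<longleftrightarrow> sat f e p \<and> sat f e b" by metis
  then show ?case using Sigma_form_Pi_form.Pi_Sigma by blast
qed


text \<open>The level is existentially quantified because only some finite level is wanted. This
  makes negation easy: a \<open>Pi_form\<close> of level n is a \<open>Sigma_form\<close> of level n
  + 1.\<close>

definition prenexable :: "nat \<Rightarrow> aform \<Rightarrow> bool" where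
  "prenexable k p \<longleftrightarrow> (\<exists>n q. Sigma_form n q \<and> fclosed k q \<and> (\<forall>f e. sat f e q = sat f e p))"

lemma prenexable_cong:
  "prenexable k q \<Longrightarrow> (\<And>f e. sat f e q = sat f e p) \<Longrightarrow> prenexable k p"
  unfolding prenexable_def by simp

lemma prenexable_bounded: "bounded_form p \<Longrightarrow> fclosed k p \<Longrightarrow> prenexable k p"
  unfolding prenexable_def using Sigma0 by blast

lemma prenexable_Ex: "prenexable (Suc k) p \<Longrightarrow> prenexable k (Ex p)"
proof -
  assume "prenexable (Suc k) p"
  then obtain n q where q: "Sigma_form n q" "fclosed (Suc k) q" "\<forall>f e. sat f e q = sat f e p"
    unfolding prenexable_def by blast
  have "Sigma_form (Suc n) (Ex q)" using q(1) by (intro Sigma_Ex Sigma_Pi_Suc)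
  then show ?thesis unfolding prenexable_def using q by (intro exI[of _ "Suc n"] exI[of _ "Ex q"]) auto
qed

lemma prenexable_Neg: "prenexable k p \<Longrightarrow> prenexable k (Neg p)"
proof -
  assume "prenexable k p"
  then obtain n q where q: "Sigma_form n q" "fclosed k q" "\<forall>f e. sat f e q = sat f e p"
    unfolding prenexable_def by blast
  obtain r where "Pi_form n r" "\<forall>k. fclosed k q \<longrightarrow> fclosed k r" "\<forall>f e. sat f e r \<longleftrightarrow> \<not> sat f e q"
    using Neg_Sigma_Pi(1)[OF q(1)] by blast
  then show ?thesis unfolding prenexable_def using q Sigma_Pi
    by (intro exI[of _ "Suc n"] exI[of _ "r"]) auto
qed

lemma prenexable_All: "prenexable (Suc k) p \<Longrightarrow> prenexable k (All p)"
  by (rule prenexable_cong[OF prenexable_Neg[OF prenexable_Ex[OF prenexable_Neg]]]) auto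

lemma prenexable_ren_Suc: "prenexable k p \<Longrightarrow> prenexable (Suc k) (ren_form Suc p)"
proof -
  assume "prenexable k p"
  then obtain n q where q: "Sigma_form n q" "fclosed k q" "\<forall>f e. sat f e q = sat f e p"
    unfolding prenexable_def by blast
  have "fclosed (Suc k) (ren_form Suc q)" using q(2) by (rule fclosed_ren) auto
  then show ?thesis unfolding prenexable_def using q
    by (intro exI[of _ n] exI[of _ "ren_form Suc q"]) (auto simp: sat_ren ren_Sigma_Pi)
qed

lemma prenexable_Conj_Sigma_Pi:
  "Sigma_form n p \<Longrightarrow> fclosed k p \<Longrightarrow> prenexable k b \<Longrightarrow> prenexable k (Conj p b)"
  "Pi_form n p \<Longrightarrow> fclosed k p \<Longrightarrow> prenexable k b \<Longrightarrow> prenexable k (Conj p b)"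
proof (induction arbitrary: b k and b k rule: Sigma_form_Pi_form.inducts)
  have bdd: "prenexable k (Conj p b)" if p: "bounded_form p" "fclosed k p" and b: "prenexable k b" for p b k
  proof -
    obtain n q where q: "Sigma_form n q" "fclosed k q" "\<forall>f e. sat f e q = sat f e b"
      using b unfolding prenexable_def by blast
    obtain r where "Sigma_form n r" "\<forall>k. fclosed k q \<and> fclosed k p \<longrightarrow> fclosed k r"
      "\<forall>f e. sat f e r \<longleftrightarrow> sat f e q \<and> sat f e p"
      using Conj_bounded_Sigma_Pi(1)[OF q(1) p(1)] by blast
    then show ?thesis unfolding prenexable_def using q p by (intro exI[of _ n] exI[of _ r]) auto
  qed
  {
    case (Sigma0 p) then show ?case by (rule bdd)
  next
    case (Pi0 p) then show ?case by (rule bdd)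
  next
    case (Sigma_Ex n p)
    have "prenexable (Suc k) (Conj p (ren_form Suc b))"
      using Sigma_Ex.prems by (intro Sigma_Ex.IH prenexable_ren_Suc) auto
    from prenexable_Ex[OF this] show ?case by (rule prenexable_cong) (auto simp: sat_ren)
  next
    case (Pi_All n p)
    have "prenexable (Suc k) (Conj p (ren_form Suc b))"
      using Pi_All.prems by (intro Pi_All.IH prenexable_ren_Suc) auto
    from prenexable_All[OF this] show ?case by (rule prenexable_cong) (auto simp: sat_ren)
  }
qed auto

lemma prenexable_Conj: "prenexable k p \<Longrightarrow> prenexable k b \<Longrightarrow> prenexable k (Conj p b)"
proof -
  assume p: "prenexable k p" and b: "prenexable k b"
  obtain n q where q: "Sigma_form n q" "fclosed k q" "\<forall>f e. sat f e q = sat f e p"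
    using p unfolding prenexable_def by blast
  show ?thesis
    by (rule prenexable_cong[OF prenexable_Conj_Sigma_Pi(1)[OF q(1,2) b]]) (use q in auto)
qed

text \<open>A bounded quantifier may stand in front of an unbounded formula here. It is replaced by
  an unbounded quantifier with a guard, at the cost of a higher level.\<close>

lemma fclosed_imp_prenexable: "fclosed k p \<Longrightarrow> prenexable k p"
proof (induction p arbitrary: k)
  case (Disj p q)
  then have "prenexable k (Neg (Conj (Neg p) (Neg q)))"
    by (intro prenexable_Neg prenexable_Conj) auto
  then show ?case by (rule prenexable_cong) auto
next
  case (BEx t p)
  have "tclosed (Suc k) (ren_term Suc t)" using BEx.prems by (intro tclosed_ren[of k]) auto
  then have "prenexable (Suc k) (Less (Var 0) (ren_term Suc t))"
    by (intro prenexable_bounded) auto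
  moreover have "prenexable (Suc k) p" using BEx by auto
  ultimately have "prenexable (Suc k) (Conj (Less (Var 0) (ren_term Suc t)) p)"
    by (intro prenexable_Conj)
  from prenexable_Ex[OF this] show ?case by (rule prenexable_cong) (auto simp: teval_ren)
next
  case (BAll t p)
  have "tclosed (Suc k) (ren_term Suc t)" using BAll.prems by (intro tclosed_ren[of k]) auto
  then have "prenexable (Suc k) (Less (Var 0) (ren_term Suc t))"
    by (intro prenexable_bounded) auto
  moreover have "prenexable (Suc k) p" using BAll by auto
  ultimately have "prenexable (Suc k) (Conj (Less (Var 0) (ren_term Suc t)) (Neg p))"
    by (intro prenexable_Conj prenexable_Neg)
  from prenexable_Neg[OF prenexable_Ex[OF this]] show ?case by (rule prenexable_cong) (auto simp: teval_ren)
next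
  case (Neg p)
  then show ?case by (intro prenexable_Neg) auto
next
  case (Conj p q)
  then show ?case by (intro prenexable_Conj) auto
next
  case (Ex p)
  then show ?case by (intro prenexable_Ex) auto
next
  case (All p)
  then show ?case by (intro prenexable_All) auto
qed (auto intro: prenexable_bounded)

lemma sat_imp_Sigma0_definable:
  assumes "fclosed 0 p"
  shows "\<exists>n. Sigma0_definable n {f. sat f (\<lambda>_. 0) p}"
  using fclosed_imp_prenexable[OF assms]
  unfolding prenexable_def Sigma0_definable_def defines_set_def by force

section \<open>Arithmetical sets are Borel\<close>

lemma borel_eval: "{f :: nat \<Rightarrow> nat. f k = m} \<in> sets borel"
proof -
  have "continuous_on UNIV (\<lambda>f :: nat \<Rightarrow> nat. f k)" by (rule continuous_on_product_coordinates)
  then have "open ((\<lambda>f :: nat \<Rightarrow> nat. f k) -` {m})" by (intro open_vimage) (auto simp: open_discrete)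
  then show ?thesis by (simp add: vimage_def)
qed

text \<open>Nested occurrences of \<open>Fn\<close> are not coordinate maps, so the possible values
  of the inner terms are split off; there are only countably many.\<close>

lemma borel_teval: "{f. teval f e t = m} \<in> sets borel"
proof (induction t arbitrary: m)
  case (Succ t)
  have "{f. teval f e (Succ t) = m} = (if m = 0 then {} else {f. teval f e t = m - 1})" by auto
  then show ?case using Succ by (auto simp del: teval.simps)
next
  case (Plus s t)
  have "{f. teval f e (Plus s t) = m} = (\<Union>i\<le>m. {f. teval f e s = i} \<inter> {f. teval f e t = m - i})" by auto
  then show ?case using Plus by (auto simp del: teval.simps)
next
  case (Times s t)
  have "{f. teval f e (Times s t) = m}
    = (\<Union>i. \<Union>j\<in>{j. i * j = m}. {f. teval f e s = i} \<inter> {f. teval f e t = j})" by auto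
  then show ?case using Times by (simp del: teval.simps)
next
  case (Fn t)
  have "{f. teval f e (Fn t) = m} = (\<Union>i. {f. teval f e t = i} \<inter> {f. f i = m})" by auto
  then show ?case using Fn borel_eval by (auto simp del: teval.simps)
qed auto

lemma borel_sat: "{f. sat f e p} \<in> sets borel"
proof (induction p arbitrary: e)
  case (Eq s t)
  have "{f. sat f e (Eq s t)} = (\<Union>m. {f. teval f e s = m} \<inter> {f. teval f e t = m})" by auto
  then show ?case using borel_teval by (auto simp del: sat.simps)
next
  case (Less s t)
  have "{f. sat f e (Less s t)} = (\<Union>m. \<Union>n\<in>{m<..}. {f. teval f e s = m} \<inter> {f. teval f e t = n})" by auto
  then show ?case using borel_teval by (auto simp del: sat.simps)
next
  case (Neg p)
  have "{f. sat f e (Neg p)} = - {f. sat f e p}" by auto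
  then show ?case using Neg by (auto simp del: sat.simps)
next
  case (Conj p q)
  have "{f. sat f e (Conj p q)} = {f. sat f e p} \<inter> {f. sat f e q}" by auto
  then show ?case using Conj by (auto simp del: sat.simps)
next
  case (Disj p q)
  have "{f. sat f e (Disj p q)} = {f. sat f e p} \<union> {f. sat f e q}" by auto
  then show ?case using Disj by (auto simp del: sat.simps)
next
  case (BEx t p)
  have "{f. sat f e (BEx t p)}
    = (\<Union>m. \<Union>x\<in>{..<m}. {f. teval f e t = m} \<inter> {f. sat f (case_nat x e) p})" by auto
  then show ?case using borel_teval BEx by (auto simp del: sat.simps)
next
  case (BAll t p)
  have "{f. sat f e (BAll t p)}
    = - (\<Union>m. \<Union>x\<in>{..<m}. {f. teval f e t = m} \<inter> - {f. sat f (case_nat x e) p})" (is "_ = - ?A") by auto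
  moreover have "?A \<in> sets borel" using borel_teval BAll by auto
  ultimately show ?case by (simp only: borel_comp)
next
  case (Ex p)
  have "{f. sat f e (Ex p)} = (\<Union>x. {f. sat f (case_nat x e) p})" by auto
  then show ?case using Ex by (auto simp del: sat.simps)
next
  case (All p)
  have "{f. sat f e (All p)} = (\<Inter>x. {f. sat f (case_nat x e) p})" by auto
  then show ?case using All by (auto simp del: sat.simps)
qed


text \<open>A predicate or term may mention the tested function \<open>f\<close> and finitely many entries of the
  environment \<open>e\<close>; binders push the bound variable in front of the environment.\<close>

definition arith :: "((nat \<Rightarrow> nat) \<Rightarrow> (nat \<Rightarrow> nat) \<Rightarrow> bool) \<Rightarrow> bool" where
  "arith P \<longleftrightarrow> (\<exists>p k. fclosed k p \<and> (\<forall>f e. sat f e p = P f e))"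

text \<open>The graph is used, with the value in slot 0, so that functions without a term in the
  language are covered, such as least witnesses. \<open>sarith\<close> and \<open>farith\<close>
  allow sets and functions computed from f and e as parameters, although the language has no
  variables for them.\<close>

definition tarith :: "((nat \<Rightarrow> nat) \<Rightarrow> (nat \<Rightarrow> nat) \<Rightarrow> nat) \<Rightarrow> bool" where
  "tarith T \<longleftrightarrow> arith (\<lambda>f e. e 0 = T f (\<lambda>i. e (Suc i)))"

definition sarith :: "((nat \<Rightarrow> nat) \<Rightarrow> (nat \<Rightarrow> nat) \<Rightarrow> nat set) \<Rightarrow> bool" where
  "sarith X \<longleftrightarrow> arith (\<lambda>f e. e 0 \<in> X f (\<lambda>i. e (Suc i)))"

definition farith :: "((nat \<Rightarrow> nat) \<Rightarrow> (nat \<Rightarrow> nat) \<Rightarrow> nat \<Rightarrow> nat) \<Rightarrow> bool" where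
  "farith F \<longleftrightarrow> tarith (\<lambda>f e. F f (\<lambda>i. e (Suc i)) (e 0))"

lemma arithI: "fclosed k p \<Longrightarrow> (\<And>f e. sat f e p = P f e) \<Longrightarrow> arith P"
  unfolding arith_def by blast

lemma arith_ren: "arith P \<Longrightarrow> arith (\<lambda>f e. P f (\<lambda>i. e (r i)))"
proof -
  assume "arith P"
  then obtain p k where p: "fclosed k p" "\<forall>f e. sat f e p = P f e" unfolding arith_def by blast
  have "fclosed (Suc (\<Sum>i<k. r i)) (ren_form r p)"
    using p(1) by (rule fclosed_ren) (metis finite_lessThan le_imp_less_Suc lessThan_iff member_le_sum zero_le)
  then show ?thesis by (rule arithI) (use p in \<open>auto simp: sat_ren\<close>)
qed

lemma tarith_ren: "tarith T \<Longrightarrow> tarith (\<lambda>f e. T f (\<lambda>i. e (r i)))"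
  unfolding tarith_def by (drule arith_ren[where r="case_nat 0 (\<lambda>i. Suc (r i))"]) simp

lemma sarith_ren: "sarith T \<Longrightarrow> sarith (\<lambda>f e. T f (\<lambda>i. e (r i)))"
  unfolding sarith_def by (drule arith_ren[where r="case_nat 0 (\<lambda>i. Suc (r i))"]) simp

lemma farith_ren: "farith T \<Longrightarrow> farith (\<lambda>f e. T f (\<lambda>i. e (r i)))"
  unfolding farith_def by (drule tarith_ren[where r="case_nat 0 (\<lambda>i. Suc (r i))"]) simp

named_theorems arith_intros

lemma arith_neg [arith_intros]: "arith P \<Longrightarrow> arith (\<lambda>f e. \<not> P f e)"
  unfolding arith_def by (metis fclosed.simps(3) sat.simps(3))

lemma arith_conj [arith_intros]: "arith P \<Longrightarrow> arith Q \<Longrightarrow> arith (\<lambda>f e. P f e \<and> Q f e)"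
proof -
  assume "arith P" "arith Q"
  then obtain p k q l where "fclosed k p" "\<forall>f e. sat f e p = P f e" "fclosed l q" "\<forall>f e. sat f e q = Q f e"
    unfolding arith_def by blast
  then show ?thesis
    by (intro arithI[of "max k l" "Conj p q"]) (auto intro: fclosed_mono)
qed

lemma arith_disj [arith_intros]: "arith P \<Longrightarrow> arith Q \<Longrightarrow> arith (\<lambda>f e. P f e \<or> Q f e)"
  using arith_neg[OF arith_conj[OF arith_neg arith_neg], of P Q] by simp

lemma arith_imp [arith_intros]: "arith P \<Longrightarrow> arith Q \<Longrightarrow> arith (\<lambda>f e. P f e \<longrightarrow> Q f e)"
  unfolding imp_conv_disj by (intro arith_disj arith_neg)

lemma arith_iff [arith_intros]: "arith P \<Longrightarrow> arith Q \<Longrightarrow> arith (\<lambda>f e. P f e \<longleftrightarrow> Q f e)"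
  unfolding iff_conv_conj_imp by (intro arith_conj arith_imp)

lemma arith_ex [arith_intros]:
  assumes "arith (\<lambda>f e. P f (\<lambda>i. e (Suc i)) (e 0))"
  shows "arith (\<lambda>f e. \<exists>x. P f e x)"
proof -
  obtain p k where "fclosed k p" "\<forall>f e. sat f e p = P f (\<lambda>i. e (Suc i)) (e 0)"
    using assms unfolding arith_def by blast
  then show ?thesis by (intro arithI[of k "Ex p"]) (auto intro: fclosed_mono)
qed

lemma arith_all [arith_intros]:
  assumes "arith (\<lambda>f e. P f (\<lambda>i. e (Suc i)) (e 0))"
  shows "arith (\<lambda>f e. \<forall>x. P f e x)"
  using arith_neg[OF arith_ex[of "\<lambda>f e x. \<not> P f e x", OF arith_neg[OF assms]]] by (simp only: not_ex not_not)

lemma tarith_var [arith_intros]: "tarith (\<lambda>f e. e n)"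
  unfolding tarith_def by (rule arithI[of "Suc (Suc n)" "Eq (Var 0) (Var (Suc n))"]) auto

lemma arith_subst:
  assumes T: "tarith T" and P: "arith (\<lambda>f e. P f (\<lambda>i. e (Suc i)) (e 0))"
  shows "arith (\<lambda>f e. P f e (T f e))"
proof -
  have "arith (\<lambda>f e. \<exists>x. x = T f e \<and> P f e x)"
    using T P unfolding tarith_def by (intro arith_ex arith_conj)
  then show ?thesis by simp
qed

lemma tarith_subst:
  assumes T: "tarith T" and U: "tarith (\<lambda>f e. U f (\<lambda>i. e (Suc i)) (e 0))"
  shows "tarith (\<lambda>f e. U f e (T f e))"
  unfolding tarith_def
  by (rule arith_subst[OF tarith_ren[OF T, of Suc], where P="\<lambda>f e x. e 0 = U f (\<lambda>i. e (Suc i)) x"])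
     (use arith_ren[OF U[unfolded tarith_def], of "case_nat 1 (case_nat 0 (\<lambda>i. Suc (Suc i)))"] in simp)

lemma arith_rel2:
  assumes Q: "arith (\<lambda>f e. Q (e 0) (e 1))" and S: "tarith S" and T: "tarith T"
  shows "arith (\<lambda>f e. Q (S f e) (T f e))"
proof (rule arith_subst[OF S, where P="\<lambda>f e x. Q x (T f e)"])
  show "arith (\<lambda>f e. Q (e 0) (T f (\<lambda>i. e (Suc i))))"
    by (rule arith_subst[OF tarith_ren[OF T], where P="\<lambda>f e x. Q (e 0) x"])
       (use arith_ren[OF Q, of "case_nat 1 (case_nat 0 (\<lambda>i. i))"] in simp)
qed

lemma tarith_fun1:
  assumes Q: "tarith (\<lambda>f e. F (e 0))" and S: "tarith S"
  shows "tarith (\<lambda>f e. F (S f e))"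
  by (rule tarith_subst[OF S, where U="\<lambda>f e x. F x"]) (use Q in simp)

lemma tarith_fun2:
  assumes Q: "tarith (\<lambda>f e. F (e 0) (e 1))" and S: "tarith S" and T: "tarith T"
  shows "tarith (\<lambda>f e. F (S f e) (T f e))"
proof (rule tarith_subst[OF S, where U="\<lambda>f e x. F x (T f e)"])
  show "tarith (\<lambda>f e. F (e 0) (T f (\<lambda>i. e (Suc i))))"
    by (rule tarith_subst[OF tarith_ren[OF T], where U="\<lambda>f e x. F (e 0) x"])
       (use tarith_ren[OF Q, of "case_nat 1 (case_nat 0 (\<lambda>i. i))"] in simp)
qed

lemma arith_eq [arith_intros]: "tarith S \<Longrightarrow> tarith T \<Longrightarrow> arith (\<lambda>f e. S f e = T f e)"
  by (rule arith_rel2[of "(=)"]) (auto intro: arithI[of 2 "Eq (Var 0) (Var 1)"])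

lemma arith_less [arith_intros]: "tarith S \<Longrightarrow> tarith T \<Longrightarrow> arith (\<lambda>f e. S f e < T f e)"
  by (rule arith_rel2[of "(<)"]) (auto intro: arithI[of 2 "Less (Var 0) (Var 1)"])

lemma arith_le [arith_intros]: "tarith S \<Longrightarrow> tarith T \<Longrightarrow> arith (\<lambda>f e. S f e \<le> T f e)"
  using arith_neg[OF arith_less, of T S] by (simp add: not_less)

lemma tarith_plus [arith_intros]: "tarith S \<Longrightarrow> tarith T \<Longrightarrow> tarith (\<lambda>f e. S f e + T f e)"
proof (rule tarith_fun2[of "(+)"])
  show "tarith (\<lambda>f e. e 0 + e 1)"
    unfolding tarith_def by (rule arithI[of 3 "Eq (Var 0) (Plus (Var 1) (Var 2))"]) (auto simp: numeral_2_eq_2)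
qed

lemma tarith_times [arith_intros]: "tarith S \<Longrightarrow> tarith T \<Longrightarrow> tarith (\<lambda>f e. S f e * T f e)"
proof (rule tarith_fun2[of "(*)"])
  show "tarith (\<lambda>f e. e 0 * e 1)"
    unfolding tarith_def by (rule arithI[of 3 "Eq (Var 0) (Times (Var 1) (Var 2))"]) (auto simp: numeral_2_eq_2)
qed

lemma tarith_Suc [arith_intros]: "tarith S \<Longrightarrow> tarith (\<lambda>f e. Suc (S f e))"
  by (rule tarith_fun1[of Suc]) (auto simp: tarith_def intro: arithI[of 2 "Eq (Var 0) (Succ (Var 1))"])

lemma tarith_oracle [arith_intros]: "tarith S \<Longrightarrow> tarith (\<lambda>f e. f (S f e))"
  by (rule tarith_subst[of S "\<lambda>f e x. f x"]) (auto simp: tarith_def intro: arithI[of 2 "Eq (Var 0) (Fn (Var 1))"])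

lemma tarith_const [arith_intros]: "tarith (\<lambda>f e. c)"
proof (induction c)
  case 0
  then show ?case unfolding tarith_def by (rule arithI[of 1 "Eq (Var 0) Zero"]) auto
qed (rule tarith_Suc)

lemma farith_oracle: "farith (\<lambda>f e. f)"
  unfolding farith_def by (intro arith_intros)

lemma tarith_app:
  assumes "farith F" "tarith T"
  shows "tarith (\<lambda>f e. F f e (T f e))"
  using assms(1) unfolding farith_def by (rule tarith_subst[OF assms(2)])

lemma arith_mem:
  assumes "sarith X" "tarith T"
  shows "arith (\<lambda>f e. T f e \<in> X f e)"
  using assms(1) unfolding sarith_def by (rule arith_subst[OF assms(2)])

lemma sarith_Collect: "arith (\<lambda>f e. P f (\<lambda>i. e (Suc i)) (e 0)) \<Longrightarrow> sarith (\<lambda>f e. {x. P f e x})"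
  by (simp add: sarith_def)

lemma sarith_UNIV: "sarith (\<lambda>f e. UNIV)"
  unfolding sarith_def by (rule arithI[of 0 "Eq Zero Zero"]) auto

lemma tarith_least [arith_intros]:
  assumes "arith (\<lambda>f e. P f (\<lambda>i. e (Suc i)) (e 0))"
  shows "tarith (\<lambda>f e. LEAST x. P f e x)"
proof -
  \<comment> \<open>If there is no witness, the value is \<open>LEAST x. False\<close>, an
    unspecified but fixed number and hence a constant.\<close>
  have *: "y = (LEAST x. P f e x) \<longleftrightarrow>
    P f e y \<and> (\<forall>z. z < y \<longrightarrow> \<not> P f e z) \<or> \<not> (\<exists>x. P f e x) \<and> y = (LEAST x. False)" for f e y
  proof (cases "\<exists>x. P f e x")
    case True
    then show ?thesis by (metis LeastI_ex Least_equality not_less not_less_Least)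
  next
    case False
    then have "P f e = (\<lambda>_. False)" by auto
    then show ?thesis by simp
  qed
  let ?P = "\<lambda>r s. arith (\<lambda>f e. P f (\<lambda>i. e (r i)) (e s))"
  have P: "?P r s" for r s
    using arith_ren[OF assms, of "case_nat s r"] by simp
  show ?thesis unfolding tarith_def * by (intro arith_intros P)
qed

lemma tarith_if [arith_intros]:
  assumes "arith P" "tarith S" "tarith T"
  shows "tarith (\<lambda>f e. if P f e then S f e else T f e)"
proof -
  have *: "x = (if A then s else t) \<longleftrightarrow> A \<and> x = s \<or> \<not> A \<and> x = t" for A and x s t :: nat by auto
  show ?thesis unfolding tarith_def *
    by (intro arith_intros arith_ren[OF assms(1)] tarith_ren[OF assms(2)] tarith_ren[OF assms(3)])
qed

lemma tarith_diff [arith_intros]: "tarith S \<Longrightarrow> tarith T \<Longrightarrow> tarith (\<lambda>f e. S f e - T f e)"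
proof (rule tarith_fun2[of "(-)"])
  have *: "x - y = (LEAST d. x \<le> y + d)" for x y :: nat
    by (rule Least_equality[symmetric]) auto
  show "tarith (\<lambda>f e. e 0 - e 1)" unfolding * by (intro arith_intros)
qed

lemma tarith_mod [arith_intros]: "tarith S \<Longrightarrow> tarith T \<Longrightarrow> tarith (\<lambda>f e. S f e mod T f e)"
proof (rule tarith_fun2[of "(mod)"])
  have *: "x mod y = (LEAST r. \<exists>q. x = q * y + r)" for x y :: nat
    by (rule Least_equality[symmetric]) (metis div_mult_mod_eq, metis mod_less_eq_dividend mod_mult_self3)
  show "tarith (\<lambda>f e. e 0 mod e 1)" unfolding * by (intro arith_intros)
qed

lemma tarith_div [arith_intros]: "tarith S \<Longrightarrow> tarith T \<Longrightarrow> tarith (\<lambda>f e. S f e div T f e)"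
proof (rule tarith_fun2[of "(div)"])
  have *: "x div y = (if y = 0 then 0 else LEAST q. x < (q + 1) * y)" for x y :: nat
  proof (cases "y = 0")
    case False
    then have "x < (q + 1) * y \<longleftrightarrow> x div y \<le> q" for q
      using div_less_iff_less_mult[of y x "q + 1"] by auto
    then have "(LEAST q. x < (q + 1) * y) = x div y" by (intro Least_equality) auto
    then show ?thesis using False by simp
  qed simp
  show "tarith (\<lambda>f e. e 0 div e 1)" unfolding * by (intro arith_intros)
qed

lemma tarith_max [arith_intros]: "tarith S \<Longrightarrow> tarith T \<Longrightarrow> tarith (\<lambda>f e. max (S f e) (T f e))"
  unfolding max_def by (intro arith_intros)

lemma tarith_min [arith_intros]: "tarith S \<Longrightarrow> tarith T \<Longrightarrow> tarith (\<lambda>f e. min (S f e) (T f e))"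
  unfolding min_def by (intro arith_intros)

lemma tarith_prod_encode [arith_intros]:
  "tarith S \<Longrightarrow> tarith T \<Longrightarrow> tarith (\<lambda>f e. prod_encode (S f e, T f e))"
  unfolding prod_encode_def triangle_def prod.case by (intro arith_intros)

lemma tarith_fst [arith_intros]: "tarith S \<Longrightarrow> tarith (\<lambda>f e. fst (prod_decode (S f e)))"
proof (rule tarith_fun1[of "\<lambda>c. fst (prod_decode c)"])
  have *: "fst (prod_decode c) = (LEAST a. \<exists>b. c = prod_encode (a, b))" for c
    by (rule Least_equality[symmetric], rule exI[of _ "snd (prod_decode c)"]) auto
  show "tarith (\<lambda>f e. fst (prod_decode (e 0)))" unfolding * by (intro arith_intros)
qed

lemma tarith_snd [arith_intros]: "tarith S \<Longrightarrow> tarith (\<lambda>f e. snd (prod_decode (S f e)))"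
proof (rule tarith_fun1[of "\<lambda>c. snd (prod_decode c)"])
  have *: "snd (prod_decode c) = (LEAST b. \<exists>a. c = prod_encode (a, b))" for c
    by (rule Least_equality[symmetric], rule exI[of _ "fst (prod_decode c)"]) auto
  show "tarith (\<lambda>f e. snd (prod_decode (e 0)))" unfolding * by (intro arith_intros)
qed

text \<open>Goedel's beta function; it codes the computations that witness recursive definitions.\<close>

definition beta :: "nat \<Rightarrow> nat \<Rightarrow> nat" where
  "beta c i = fst (prod_decode c) mod (1 + Suc i * snd (prod_decode c))"

text \<open>M bounds N and all values, and d is the factorial of M. A prime dividing two of the
  moduli divides (j - i) * d; as j - i divides d, it divides d and therefore 1. So the moduli are
  coprime, they exceed the values, and the Chinese remainder theorem applies.\<close>

lemma beta_exists: "\<exists>c. \<forall>i<N. beta c i = a i"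
proof -
  define M where "M = N + (\<Sum>i<N. a i)"
  define d where "d = (fact M :: nat)"
  have aM: "a i \<le> M" if "i < N" for i
    using member_le_sum[of i "{..<N}" a] that by (auto simp: M_def)
  have cop: "coprime (1 + Suc i * d) (1 + Suc j * d)" if ij: "i < j" "j < N" for i j
  proof (rule ccontr)
    assume "\<not> coprime (1 + Suc i * d) (1 + Suc j * d)"
    then obtain p where p: "prime p" "p dvd 1 + Suc i * d" "p dvd 1 + Suc j * d"
      using prime_factor_nat[of "gcd (1 + Suc i * d) (1 + Suc j * d)"] unfolding coprime_iff_gcd_eq_1 by auto
    have "p dvd (1 + Suc j * d) - (1 + Suc i * d)" using p by (intro dvd_diff_nat)
    also have "(1 + Suc j * d) - (1 + Suc i * d) = (j - i) * d"
      using ij by (simp add: algebra_simps)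
    finally have "p dvd j - i \<or> p dvd d" using p(1) by (simp add: prime_dvd_mult_iff)
    moreover have "j - i dvd d" using ij unfolding d_def M_def by (intro dvd_fact) auto
    ultimately have "p dvd d" using dvd_trans by blast
    then have "p dvd 1" using p(2) dvd_add_left_iff[of p "Suc i * d" 1] by simp
    then show False using p(1) by simp
  qed
  have "\<exists>x. \<forall>i\<in>{..<N}. [x = a i] (mod (1 + Suc i * d))"
  proof (rule chinese_remainder_nat, safe)
    fix i j assume "i < N" "j < N" "i \<noteq> j"
    then show "coprime (1 + Suc i * d) (1 + Suc j * d)"
      using cop[of i j] cop[of j i] by (cases "i < j") (simp_all only: coprime_commute linorder_neq_iff, auto)
  qed
  then obtain x where x: "\<And>i. i < N \<Longrightarrow> [x = a i] (mod (1 + Suc i * d))" by auto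
  have "beta (prod_encode (x, d)) i = a i" if "i < N" for i
  proof -
    have "M \<le> d" unfolding d_def by (rule fact_ge_self)
    then have "a i < 1 + Suc i * d" using aM[OF that] by (simp add: le_imp_less_Suc trans_le_add1)
    then show ?thesis using x[OF that] by (simp add: beta_def cong_def del: mult_Suc)
  qed
  then show ?thesis by blast
qed

lemma tarith_beta [arith_intros]: "tarith S \<Longrightarrow> tarith T \<Longrightarrow> tarith (\<lambda>f e. beta (S f e) (T f e))"
  unfolding beta_def by (intro arith_intros)

lemma tarith_rec [arith_intros]:
  assumes Z: "tarith Z" and S: "tarith (\<lambda>f e. S f (\<lambda>i. e (Suc (Suc i))) (e 1) (e 0))" and T: "tarith T"
  shows "tarith (\<lambda>f e. rec_nat (Z f e) (\<lambda>j y. S f e j y) (T f e))"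
proof -
  have *: "rec_nat z s n =
    (LEAST v. \<exists>c. beta c 0 = z \<and> (\<forall>i. i < n \<longrightarrow> beta c (Suc i) = s i (beta c i)) \<and> beta c n = v)" for z s n
  proof (rule Least_equality[symmetric])
    obtain c where "\<forall>i<Suc n. beta c i = rec_nat z s i" using beta_exists by blast
    then show "\<exists>c. beta c 0 = z \<and> (\<forall>i. i < n \<longrightarrow> beta c (Suc i) = s i (beta c i)) \<and> beta c n = rec_nat z s n"
      by (intro exI[of _ c]) auto
  next
    fix v assume "\<exists>c. beta c 0 = z \<and> (\<forall>i. i < n \<longrightarrow> beta c (Suc i) = s i (beta c i)) \<and> beta c n = v"
    then obtain c where c: "beta c 0 = z" "\<forall>i. i < n \<longrightarrow> beta c (Suc i) = s i (beta c i)" "beta c n = v" by blast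
    have "i \<le> n \<Longrightarrow> beta c i = rec_nat z s i" for i by (induction i) (auto simp: c)
    then show "rec_nat z s n \<le> v" using c by auto
  qed
  \<comment> \<open>The step function reappears under further binders, so it is supplied for
    arbitrary positions of its arguments in the environment.\<close>
  have S': "tarith (\<lambda>f e. S f (\<lambda>i. e (r i)) (e m) (beta (e k) (e l)))" for r m k l
  proof (rule tarith_subst[where U="\<lambda>f e x. S f (\<lambda>i. e (r i)) (e m) x" and T="\<lambda>f e. beta (e k) (e l)"])
    show "tarith (\<lambda>f e. S f (\<lambda>i. e (Suc (r i))) (e (Suc m)) (e 0))"
      using tarith_ren[OF S, of "case_nat 0 (case_nat (Suc m) (\<lambda>i. Suc (r i)))"] by simp
  qed (intro arith_intros)
  show ?thesis unfolding * by (intro arith_intros tarith_ren[OF Z] tarith_ren[OF T] S')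
qed

lemma arith_imp_definable:
  assumes "arith (\<lambda>f e. P f)"
  shows "(\<exists>n. Sigma0_definable n {f. P f}) \<and> {f. P f} \<in> sets borel"
proof -
  obtain p k where p: "fclosed k p" "\<forall>f e. sat f e p = P f" using assms unfolding arith_def by blast
  \<comment> \<open>The truth of p does not depend on its k free variables, so quantifying them away
    yields an equivalent sentence.\<close>
  define q where "q = (Ex ^^ k) p"
  have "fclosed 0 ((Ex ^^ k) p) \<and> (\<forall>f e. sat f e ((Ex ^^ k) p) = P f)"
    using p
  proof (induction k arbitrary: p)
    case (Suc k)
    from Suc.IH[of "Ex p"] Suc.prems show ?case by (auto simp: funpow_swap1)
  qed auto
  then have q: "fclosed 0 q" "{f. sat f (\<lambda>_. 0) q} = {f. P f}" by (auto simp: q_def)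
  show ?thesis using sat_imp_Sigma0_definable[OF q(1)] borel_sat[of "\<lambda>_. 0" q] unfolding q(2) by blast
qed

section \<open>The base action\<close>

text \<open>The passage from words to primitive recursion, to which \<open>tarith_rec\<close>
  applies.\<close>

lemma fold_map_upt_eq_rec_nat: "fold F (map g [0..<l]) a = rec_nat a (\<lambda>i. F (g i)) l"
  by (induction l) auto

text \<open>The letters act on the ball of radius \<open>L\<close> in the Cayley graph of a free product of groups of order two,
  fixing a word when it cannot be extended; a short reduced word then moves the empty word. Acting by
  composition on all permutations of the ball makes this action free.\<close>

lemma high_girth_involutions:
  fixes S L M :: nat
  shows "\<exists>v \<pi>. M < v \<and> (\<forall>s a. s < S \<longrightarrow> a < v \<longrightarrow> \<pi> s a < v \<and> \<pi> s (\<pi> s a) = (a :: nat)) \<and>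
    (\<forall>w a. a < v \<longrightarrow> w \<noteq> [] \<longrightarrow> length w \<le> L \<longrightarrow> set w \<subseteq> {..<S} \<longrightarrow> distinct_adj w \<longrightarrow> fold \<pi> w a \<noteq> a)"
proof -
  define B where "B = {w :: nat list. set w \<subseteq> {..<S} \<and> length w \<le> L \<and> distinct_adj w}"
  define p where "p s w = (if w \<notin> B then w else if w \<noteq> [] \<and> hd w = s then tl w
    else if length w < L then s # w else w)" for s and w :: "nat list"
  have finB: "finite B"
    by (rule finite_subset[OF _ finite_lists_length_le[of "{..<S}" L]]) (auto simp: B_def)
  have pB: "p s w \<in> B" if "s < S" "w \<in> B" for s w
    using that by (cases w) (auto simp: p_def B_def distinct_adj_Cons)
  have pp: "p s (p s w) = w" if "s < S" for s w
    using that by (cases w) (auto simp: p_def B_def distinct_adj_Cons)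
  have perm: "p s permutes B" if "s < S" for s
  proof -
    have "p s w = w" if "w \<notin> B" for w using that by (simp add: p_def)
    then show ?thesis using pp[OF that] unfolding permutes_def by metis
  qed
  have path: "fold p w [] = rev w" if "w \<in> B" for w
    using that
  proof (induction w rule: rev_induct)
    case (snoc s w)
    then have "w \<in> B" by (auto simp: B_def distinct_adj_append_iff)
    moreover have "rev w = [] \<or> hd (rev w) \<noteq> s"
      using snoc.prems by (cases "w = []") (auto simp: B_def distinct_adj_append_iff hd_rev)
    ultimately show ?case using snoc by (auto simp: p_def B_def)
  qed simp
  \<comment> \<open>The second coordinate is inert; it only makes the number of points exceed
    M.\<close>
  define V where "V = {f. f permutes B} \<times> {..M}"
  define act where "act s x = (p s \<circ> fst x, snd x)" for s and x :: "(nat list \<Rightarrow> nat list) \<times> nat"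
  have finV: "finite V" using finB by (auto simp: V_def finite_permutations)
  have "card V = fact (card B) * Suc M"
    using finB by (simp add: V_def card_cartesian_product card_permutations)
  then have cardV: "M < card V"
    by (metis fact_ge_1 less_Suc_eq_le mult_le_mono1 nat_mult_1 order_less_le_trans lessI of_nat_id)
  have actV: "act s x \<in> V" if "s < S" "x \<in> V" for s x
    using that perm by (auto simp: V_def act_def intro: permutes_compose)
  have actact: "act s (act s x) = x" if "s < S" for s x
    using pp[OF that] by (cases x) (auto simp: act_def fun_eq_iff)
  have fold_act: "fold act w x = (fold p w \<circ> fst x, snd x)" for w x
    by (induction w arbitrary: x) (auto simp: act_def)
  have fold_actV: "fold act w x \<in> V" if "set w \<subseteq> {..<S}" "x \<in> V" for w x
    using that by (induction w arbitrary: x) (auto simp: actV)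
  \<comment> \<open>If composing with \<open>fold p w\<close> fixes a permutation, then
    \<open>fold p w\<close> fixes everything in its range, in particular the empty word, which
    \<open>path\<close> shows to be moved.\<close>
  have free: "fold act w x \<noteq> x" if "x \<in> V" "w \<in> B" "w \<noteq> []" for w x
  proof
    assume "fold act w x = x"
    then have *: "fold p w (fst x v) = fst x v" for v unfolding fold_act by (simp add: prod_eq_iff fun_eq_iff)
    have "surj (fst x)" using that(1) permutes_surj[of "fst x" B] by (simp add: V_def mem_Times_iff)
    then obtain v where "fst x v = []" by (metis surjD)
    then have "fold p w [] = []" using *[of v] by simp
    then show False using path[OF that(2)] that(3) by simp
  qed
  obtain h where h: "bij_betw h V {..<card V}"
    using ex_bij_betw_finite_nat[OF finV] by (auto simp: atLeast0LessThan)
  define g where "g = the_inv_into V h"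
  have gV: "g a \<in> V" and hg: "h (g a) = a" if "a < card V" for a
    using h that unfolding g_def bij_betw_def
    by (auto simp: the_inv_into_into f_the_inv_into_f)
  have gh: "g (h x) = x" if "x \<in> V" for x
    using h that unfolding g_def bij_betw_def by (auto simp: the_inv_into_f_f)
  have hV: "h x < card V" if "x \<in> V" for x
    using h that unfolding bij_betw_def by auto
  define \<pi> where "\<pi> s a = h (act s (g a))" for s a
  have fold_pi: "fold \<pi> w a = h (fold act w (g a))" if "a < card V" "set w \<subseteq> {..<S}" for w a
    using that
  proof (induction w arbitrary: a)
    case (Cons s w)
    then have "\<pi> s a < card V" by (auto simp: \<pi>_def intro!: hV actV gV)
    then show ?case using Cons by (auto simp: \<pi>_def gh actV gV)
  qed (simp add: hg)
  have "\<pi> s a < card V \<and> \<pi> s (\<pi> s a) = a" if "s < S" "a < card V" for s a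
    using that by (auto simp: \<pi>_def gh actV gV actact hg intro!: hV)
  moreover have "fold \<pi> w a \<noteq> a"
    if "a < card V" "w \<noteq> []" "length w \<le> L" "set w \<subseteq> {..<S}" "distinct_adj w" for w a
  proof -
    have "w \<in> B" using that by (auto simp: B_def)
    then have "fold act w (g a) \<noteq> g a" using that by (intro free gV)
    then have "g (h (fold act w (g a))) \<noteq> g a" using that by (simp add: gh fold_actV gV)
    then show ?thesis using that by (auto simp: fold_pi)
  qed
  ultimately show ?thesis using cardV by blast
qed

text \<open>The action table z and the words y are numbers read by \<open>beta\<close>, so that the
  condition is arithmetical. There are at most (n + 1) * 2 ^ (n * n) words of length at most n over
  2 ^ n letters; the extra factor n lets the pigeonhole principle give more than n points to one
  word. With \<open>Suc n\<close> as bound on the length, a single letter has no fixed point even in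
  block 0.\<close>

definition base_ok :: "nat \<Rightarrow> nat \<Rightarrow> nat \<Rightarrow> bool" where
  "base_ok n v z \<longleftrightarrow> n * (n + 1) * 2 ^ (n * n) < v \<and>
     (\<forall>s a. s < 2 ^ n \<longrightarrow> a < v \<longrightarrow> beta z (prod_encode (s, a)) < v \<and>
        beta z (prod_encode (s, beta z (prod_encode (s, a)))) = a) \<and>
     (\<forall>l y a. 0 < l \<longrightarrow> l \<le> Suc n \<longrightarrow> a < v \<longrightarrow> (\<forall>i. i < l \<longrightarrow> beta y i < 2 ^ n) \<longrightarrow>
        (\<forall>i. Suc i < l \<longrightarrow> beta y i \<noteq> beta y (Suc i)) \<longrightarrow>
        rec_nat a (\<lambda>i x. beta z (prod_encode (beta y i, x))) l \<noteq> a)"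

lemma base_ok_exists: "\<exists>v z. base_ok n v z"
proof -
  obtain v and \<pi> :: "nat \<Rightarrow> nat \<Rightarrow> nat" where v: "n * (n + 1) * 2 ^ (n * n) < v"
    and pi: "\<forall>s a. s < 2 ^ n \<longrightarrow> a < v \<longrightarrow> \<pi> s a < v \<and> \<pi> s (\<pi> s a) = (a :: nat)"
    and girth: "\<forall>w a. a < v \<longrightarrow> w \<noteq> [] \<longrightarrow> length w \<le> Suc n \<longrightarrow> set w \<subseteq> {..<2 ^ n} \<longrightarrow> distinct_adj w
      \<longrightarrow> fold \<pi> w a \<noteq> a"
    using high_girth_involutions[of "n * (n + 1) * 2 ^ (n * n)" "2 ^ n" "Suc n"] by (elim exE conjE)
  define N where "N = Suc (\<Sum>s<2 ^ n. \<Sum>a<v. prod_encode (s, a))"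
  have N: "prod_encode (s, a) < N" if "s < 2 ^ n" "a < v" for s a
  proof -
    have "prod_encode (s, a) \<le> (\<Sum>a<v. prod_encode (s, a))"
      using that by (intro member_le_sum) auto
    also have "\<dots> \<le> (\<Sum>s<2 ^ n. \<Sum>a<v. prod_encode (s, a))"
      using that by (intro member_le_sum[where f="\<lambda>s. \<Sum>a<v. prod_encode (s, a)"]) auto
    finally show ?thesis by (simp add: N_def)
  qed
  obtain z where "\<forall>i<N. beta z i = \<pi> (fst (prod_decode i)) (snd (prod_decode i))"
    using beta_exists[of N "\<lambda>i. \<pi> (fst (prod_decode i)) (snd (prod_decode i))"] by blast
  then have z: "beta z (prod_encode (s, a)) = \<pi> s a" if "s < 2 ^ n" "a < v" for s a
    using N[OF that] by simp
  have "rec_nat a (\<lambda>i x. beta z (prod_encode (beta y i, x))) l \<noteq> a"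
    if l: "0 < l" "l \<le> Suc n" and a: "a < v" and y: "\<And>i. i < l \<Longrightarrow> beta y i < 2 ^ n"
      and adj: "\<And>i. Suc i < l \<Longrightarrow> beta y i \<noteq> beta y (Suc i)" for l y a
  proof -
    have *: "j \<le> l \<Longrightarrow> rec_nat a (\<lambda>i x. beta z (prod_encode (beta y i, x))) j = fold \<pi> (map (beta y) [0..<j]) a
      \<and> fold \<pi> (map (beta y) [0..<j]) a < v" for j
      by (induction j) (auto simp: a z y pi)
    have "fold \<pi> (map (beta y) [0..<l]) a \<noteq> a"
      using l a y adj by (intro girth[rule_format]) (auto simp: distinct_adj_conv_nth)
    then show ?thesis using * by simp
  qed
  then have "base_ok n v z"
    unfolding base_ok_def using v z pi by auto
  then show ?thesis by blast
qed

text \<open>Any choice of a block structure will do; the least code is an arithmetical one.\<close>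

definition base_code :: "nat \<Rightarrow> nat" where
  "base_code n = (LEAST c. base_ok n (fst (prod_decode c)) (snd (prod_decode c)))"

definition base_size :: "nat \<Rightarrow> nat" where
  "base_size n = fst (prod_decode (base_code n))"

definition base_act :: "nat \<Rightarrow> nat \<Rightarrow> nat \<Rightarrow> nat" where
  "base_act n s a = beta (snd (prod_decode (base_code n))) (prod_encode (s, a))"

lemma base_ok_base: "base_ok n (base_size n) (snd (prod_decode (base_code n)))"
proof -
  obtain v z where "base_ok n v z" using base_ok_exists by blast
  then have "base_ok n (fst (prod_decode (prod_encode (v, z)))) (snd (prod_decode (prod_encode (v, z))))" by simp
  then show ?thesis unfolding base_size_def base_code_def by (rule LeastI)
qed

lemma base_size_gt: "n * (n + 1) * 2 ^ (n * n) < base_size n"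
  using base_ok_base[of n] unfolding base_ok_def by blast

lemma base_act_less: "s < 2 ^ n \<Longrightarrow> a < base_size n \<Longrightarrow> base_act n s a < base_size n"
  using base_ok_base[of n] unfolding base_ok_def base_act_def by blast

lemma base_act_act: "s < 2 ^ n \<Longrightarrow> a < base_size n \<Longrightarrow> base_act n s (base_act n s a) = a"
  using base_ok_base[of n] unfolding base_ok_def base_act_def by blast

lemma base_act_girth:
  assumes "w \<noteq> []" "length w \<le> Suc n" "a < base_size n" "set w \<subseteq> {..<2 ^ n}" "distinct_adj w"
  shows "fold (base_act n) w a \<noteq> a"
proof -
  obtain y where y: "\<forall>i<length w. beta y i = w ! i" using beta_exists[of "length w" "(!) w"] by blast
  have "rec_nat a (\<lambda>i x. beta (snd (prod_decode (base_code n))) (prod_encode (beta y i, x))) (length w) \<noteq> a"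
    using assms y base_ok_base[of n] unfolding base_ok_def
    by (auto simp: distinct_adj_conv_nth subset_iff)
  moreover have "map (beta y) [0..<length w] = w" using y by (intro nth_equalityI) auto
  ultimately show ?thesis
    using fold_map_upt_eq_rec_nat[of "base_act n" "beta y" "length w" a] unfolding base_act_def by simp
qed

definition offset :: "nat \<Rightarrow> nat" where
  "offset n = rec_nat 0 (\<lambda>i y. y + base_size i) n"

definition block :: "nat \<Rightarrow> nat" where
  "block a = (LEAST n. a < offset (Suc n))"

text \<open>The letter that represents \<xi> in block n, as a number below 2 ^ n.\<close>

definition trunc :: "nat set \<Rightarrow> nat \<Rightarrow> nat" where
  "trunc \<xi> n = set_encode (\<xi> \<inter> {..<n})"

definition base :: "nat set \<Rightarrow> nat \<Rightarrow> nat" where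
  "base \<xi> a = offset (block a) + base_act (block a) (trunc \<xi> (block a)) (a - offset (block a))"

lemma trunc_less: "trunc \<xi> n < 2 ^ n"
proof -
  have "trunc \<xi> n \<le> set_encode {..<n}" unfolding trunc_def set_encode_def
    by (intro sum_mono2) auto
  also have "\<dots> < 2 ^ n" unfolding set_encode_def lessThan_atLeast0 by (simp add: sum_power2)
  finally show ?thesis .
qed

lemma trunc_eq_iff: "trunc \<xi> n = trunc \<eta> n \<longleftrightarrow> \<xi> \<inter> {..<n} = \<eta> \<inter> {..<n}"
  unfolding trunc_def by (simp add: set_encode_eq)

lemma offset_Suc: "offset (Suc n) = offset n + base_size n"
  by (simp add: offset_def)

lemma base_size_pos: "0 < base_size n"
  using base_size_gt[of n] by simp

lemma offset_strict_mono: "strict_mono offset"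
  by (rule strict_monoI_Suc) (simp add: offset_Suc base_size_pos)

lemma block_eq_iff: "block a = n \<longleftrightarrow> offset n \<le> a \<and> a < offset (Suc n)"
proof -
  have "a < offset (Suc a)" using strict_mono_imp_increasing[OF offset_strict_mono, of "Suc a"] by simp
  then have 1: "a < offset (Suc (block a))" unfolding block_def by (rule LeastI)
  have 2: "offset (block a) \<le> a"
  proof (cases "block a")
    case (Suc m)
    then have "\<not> a < offset (Suc m)" using not_less_Least[of m "\<lambda>n. a < offset (Suc n)"] unfolding block_def by simp
    then show ?thesis using Suc by simp
  qed (simp add: offset_def)
  show ?thesis
  proof
    assume "offset n \<le> a \<and> a < offset (Suc n)"
    then have "offset n < offset (Suc (block a))" "offset (block a) < offset (Suc n)" using 1 2 by auto
    then show "block a = n" unfolding strict_mono_less[OF offset_strict_mono] by simp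
  qed (use 1 2 in auto)
qed

lemma block_set: "{a. block a = n} = {offset n..<offset (Suc n)}"
  by (auto simp: block_eq_iff)

lemma finite_block: "finite {a. block a = n}"
  by (simp add: block_set)

lemma card_block: "card {a. block a = n} = base_size n"
  by (simp add: block_set offset_Suc)

lemma in_block:
  assumes "block a = n"
  shows "offset n \<le> a" "a - offset n < base_size n"
  using assms unfolding block_eq_iff offset_Suc by auto

lemma block_offset_add: "i < base_size n \<Longrightarrow> block (offset n + i) = n"
  unfolding block_eq_iff offset_Suc by auto

lemma base_in_block: "block a = n \<Longrightarrow> base \<xi> a = offset n + base_act n (trunc \<xi> n) (a - offset n)"
  by (simp add: base_def)

lemma block_base [simp]: "block (base \<xi> a) = block a"
  unfolding base_def using in_block[of a] by (intro block_offset_add base_act_less trunc_less) simp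

lemma base_base [simp]: "base \<xi> (base \<xi> a) = a"
proof -
  have "base \<xi> (base \<xi> a) = offset (block a) + base_act (block a) (trunc \<xi> (block a)) (base \<xi> a - offset (block a))"
    by (rule base_in_block) simp
  also have "\<dots> = a" using in_block[of a "block a"] by (simp add: base_def base_act_act trunc_less)
  finally show ?thesis .
qed

lemma base_cong: "trunc \<xi> (block a) = trunc \<eta> (block a) \<Longrightarrow> base \<xi> a = base \<eta> a"
  by (simp add: base_def)

lemma block_fold_base [simp]: "block (fold base w a) = block a"
  by (induction w arbitrary: a) auto

lemma fold_base_in_block:
  assumes "block a = n"
  shows "fold base w a = offset n + fold (base_act n) (map (\<lambda>\<xi>. trunc \<xi> n) w) (a - offset n)"
  using assms
proof (induction w arbitrary: a)
  case Nil
  then show ?case using in_block(1)[of a n] by simp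
next
  case (Cons \<xi> w)
  then have "fold base (\<xi> # w) a = offset n + fold (base_act n) (map (\<lambda>\<xi>. trunc \<xi> n) w) (base \<xi> a - offset n)"
    by simp
  then show ?case using base_in_block[OF Cons.prems] by simp
qed

lemma base_girth:
  assumes "w \<noteq> []" "length w \<le> Suc (block a)" "distinct_adj (map (\<lambda>\<xi>. trunc \<xi> (block a)) w)"
  shows "fold base w a \<noteq> a"
proof -
  have "fold (base_act (block a)) (map (\<lambda>\<xi>. trunc \<xi> (block a)) w) (a - offset (block a)) \<noteq> a - offset (block a)"
    using assms in_block[of a "block a"] by (intro base_act_girth) (auto simp: trunc_less)
  then show ?thesis using fold_base_in_block[OF refl, of w a] in_block[of a "block a"] by simp
qed

lemma fold_base_rev [simp]: "fold base (rev w) (fold base w a) = a"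
  by (induction w arbitrary: a) auto

lemma fold_base_inj: "fold base w a = fold base w b \<Longrightarrow> a = b"
  by (metis fold_base_rev)

text \<open>Equal last letters cancel. If the last letters differ, u followed by the reversal of v
  is a reduced closed word, which \<open>base_girth\<close> forbids.\<close>

lemma base_path_unique:
  assumes "fold base u a = fold base v a" "length u + length v \<le> block a"
    and "distinct_adj (map (\<lambda>\<xi>. trunc \<xi> (block a)) u)" "distinct_adj (map (\<lambda>\<xi>. trunc \<xi> (block a)) v)"
  shows "map (\<lambda>\<xi>. trunc \<xi> (block a)) u = map (\<lambda>\<xi>. trunc \<xi> (block a)) v"
  using assms
proof (induction u arbitrary: v rule: rev_induct)
  case Nil
  then show ?case using base_girth[of v a] by (cases "v = []") auto
next
  case (snoc \<xi> u)
  let ?t = "\<lambda>\<xi>. trunc \<xi> (block a)"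
  show ?case
  proof (cases v rule: rev_cases)
    case Nil
    then show ?thesis using snoc.prems base_girth[of "u @ [\<xi>]" a] by auto
  next
    case (snoc v' \<eta>)
    note v = this
    show ?thesis
    proof (cases "?t \<xi> = ?t \<eta>")
      case True
      have "base \<xi> (fold base u a) = base \<eta> (fold base v' a)" using snoc.prems(1) v by simp
      also have "\<dots> = base \<xi> (fold base v' a)" using True by (intro base_cong) simp
      finally have "fold base u a = fold base v' a" by (metis base_base)
      then have "map ?t u = map ?t v'" using snoc.prems v
        by (intro snoc.IH) (auto simp: distinct_adj_append_iff)
      then show ?thesis using True v by simp
    next
      case False
      have "fold base (rev v) (fold base (u @ [\<xi>]) a) = a" using snoc.prems(1) by (metis fold_base_rev)
      then have "fold base ((u @ [\<xi>]) @ rev v) a = a" by simp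
      moreover have "distinct_adj (map ?t ((u @ [\<xi>]) @ rev v))"
        using False snoc.prems(3,4) unfolding v
        by (auto simp: distinct_adj_append_iff distinct_adj_Cons rev_map[symmetric] distinct_adj_rev hd_rev)
      ultimately show ?thesis using base_girth[of "(u @ [\<xi>]) @ rev v" a] snoc.prems(2) by auto
    qed
  qed
qed

lemma base_neq: "base \<xi> a \<noteq> a"
  using base_girth[of "[\<xi>]" a] by simp

lemma fold_base_cong:
  "map (\<lambda>\<xi>. trunc \<xi> (block a)) u = map (\<lambda>\<xi>. trunc \<xi> (block a)) v \<Longrightarrow> fold base u a = fold base v a"
  by (simp add: fold_base_in_block[OF refl])

section \<open>The generators\<close>

text \<open>A block codes at most one initial segment of a set, so two different sets are coded by only finitely
  many common blocks. Every set is coded by infinitely many blocks of each colour.\<close>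

definition node :: "nat set \<Rightarrow> nat \<Rightarrow> nat" where
  "node \<xi> j = prod_encode (j, trunc \<xi> j)"

definition codes :: "nat set \<Rightarrow> nat \<Rightarrow> bool" where
  "codes \<xi> n \<longleftrightarrow> (\<exists>j. n = node \<xi> j)"

text \<open>For a block coding a set up to length j, this is the first coordinate of j. Blocks that
  code no set are coloured too, since an arrow may end in any block.\<close>

definition colour :: "nat \<Rightarrow> nat" where
  "colour n = fst (prod_decode (fst (prod_decode n)))"

text \<open>Larger colours come earlier. Thus an up arrow that starts in colour i ends in a colour
  at most i, and there the down arrows of any one generator start only finitely often.\<close>

definition before :: "nat \<Rightarrow> nat \<Rightarrow> bool" where
  "before n m \<longleftrightarrow> colour m < colour n \<or> colour m = colour n \<and> n < m"

definition graph_set :: "(nat \<Rightarrow> nat) \<Rightarrow> nat set" where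
  "graph_set x = {c. \<exists>i. c = prod_encode (i, x i)}"

definition perm_of :: "nat set \<Rightarrow> nat \<Rightarrow> nat" where
  "perm_of \<xi> i = (LEAST j. prod_encode (i, j) \<in> \<xi>)"

text \<open>The equation lets \<xi> and the permutation determine each other, so each permutation is
  served by exactly one generator. All other sets keep their base action.\<close>

definition is_perm :: "nat set \<Rightarrow> bool" where
  "is_perm \<xi> \<longleftrightarrow> bij (perm_of \<xi>) \<and> \<xi> = graph_set (perm_of \<xi>)"

text \<open>A set \<open>E\<close> together with a length \<open>l\<close> represents the word whose \<open>j\<close>-th letter is the \<open>j\<close>-th section of \<open>E\<close>.\<close>

definition sect :: "nat set \<Rightarrow> nat \<Rightarrow> nat set" where
  "sect E j = {i. prod_encode (j, i) \<in> E}"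

definition letters :: "nat set \<Rightarrow> nat \<Rightarrow> nat set list" where
  "letters E l = map (sect E) [0..<l]"

definition reduced_at :: "nat \<Rightarrow> nat set \<Rightarrow> nat \<Rightarrow> bool" where
  "reduced_at n E l \<longleftrightarrow> (\<forall>j. Suc j < l \<longrightarrow> trunc (sect E j) n \<noteq> trunc (sect E (Suc j)) n)"

text \<open>A word of length l in the altered generators differs from its base version at no more
  than 4 * l points of a block. Agreement at more than n points therefore survives the alterations
  once n is large.\<close>

definition popular :: "(nat \<Rightarrow> nat) \<Rightarrow> nat \<Rightarrow> nat set \<Rightarrow> nat \<Rightarrow> bool" where
  "popular x l E n \<longleftrightarrow> reduced_at n E l \<and> n < card {k. block k = n \<and> fold base (letters E l) k = x k}"

definition popular_code :: "(nat \<Rightarrow> nat) \<Rightarrow> nat \<Rightarrow> nat \<Rightarrow> nat" where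
  "popular_code x l n = (LEAST z. popular x l (set_decode z) n)"

text \<open>The first b bits of the limit, as a number z. Since z < 2 ^ b, equality with the
  truncation at \<open>Suc b\<close> says that the earlier bits agree and bit b is unset.\<close>

definition limit_code :: "(nat \<Rightarrow> nat set) \<Rightarrow> nat set \<Rightarrow> nat \<Rightarrow> nat" where
  "limit_code E A b =
    rec_nat 0 (\<lambda>b z. if infinite {n \<in> A. trunc (E n) (Suc b) = z} then z else z + 2 ^ b) b"

text \<open>The leftmost accumulation point of the sets \<open>E n\<close>, \<open>n \<in> A\<close>: a bit is set only if finitely many of them
  agree with the bits chosen so far and have it unset.\<close>

definition limit_set :: "(nat \<Rightarrow> nat set) \<Rightarrow> nat set \<Rightarrow> nat set" where
  "limit_set E A = {b. finite {n \<in> A. trunc (E n) (Suc b) = limit_code E A b}}"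

text \<open>This plays the role of a compactness argument. It serves to find a word close to a given
  permutation and, with all blocks allowed, to decode an element of the group.\<close>

definition word_limit :: "(nat \<Rightarrow> nat) \<Rightarrow> nat set \<Rightarrow> nat \<Rightarrow> nat set" where
  "word_limit x A l = limit_set (\<lambda>n. set_decode (popular_code x l n))
     {n \<in> A. \<exists>z. popular x l (set_decode z) n}"

definition coloured_codes :: "nat set \<Rightarrow> nat \<Rightarrow> nat set" where
  "coloured_codes \<xi> i = {n. codes \<xi> n \<and> colour n = i}"

text \<open>The four ways to choose points \<open>k\<close> at which the generator of \<open>\<xi>\<close> is made to agree with the permutation \<open>x\<close>
  coded by \<open>\<xi>\<close>. Regard \<open>k\<close> as an arrow from its block to the block of \<open>x k\<close>. Arrows of the first kind go up in
  the order \<open>before\<close> and start in a single colour, arrows of the second kind go down and start only finitely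
  often in each colour; arrows of the last two kinds stay in a block, but no fixed word leads from \<open>k\<close> to
  \<open>x k\<close> infinitely often. If none of the four is available, then \<open>x\<close> agrees infinitely often with a word.\<close>

definition cand_up :: "(nat \<Rightarrow> nat) \<Rightarrow> nat \<Rightarrow> nat \<Rightarrow> bool" where
  "cand_up x i k \<longleftrightarrow> colour (block k) = i \<and> before (block k) (block (x k))"

definition cand_down :: "(nat \<Rightarrow> nat) \<Rightarrow> nat \<Rightarrow> nat \<Rightarrow> bool" where
  "cand_down x t k \<longleftrightarrow> t \<le> colour (block k) \<and> before (block (x k)) (block k)"

definition cand_far :: "(nat \<Rightarrow> nat) \<Rightarrow> nat \<Rightarrow> nat \<Rightarrow> nat \<Rightarrow> bool" where
  "cand_far x i t k \<longleftrightarrow> colour (block k) = i \<and> block (x k) = block k \<and>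
     (\<forall>l z. l \<le> t \<longrightarrow> reduced_at (block k) (set_decode z) l \<longrightarrow> fold base (letters (set_decode z) l) k \<noteq> x k)"

text \<open>The popular words approach the limit word as t grows, while the limit word itself is not
  popular in these blocks. A fixed word leading from k to x k infinitely often would coincide with
  them in large blocks and hence be the limit.\<close>

definition cand_near :: "nat set \<Rightarrow> (nat \<Rightarrow> nat) \<Rightarrow> nat \<Rightarrow> nat \<Rightarrow> nat \<Rightarrow> nat \<Rightarrow> bool" where
  "cand_near \<xi> x i l t k \<longleftrightarrow> colour (block k) = i \<and> block (x k) = block k \<and>
     popular x l (set_decode (popular_code x l (block k))) (block k) \<and>
     fold base (letters (set_decode (popular_code x l (block k))) l) k = x k \<and>
     trunc (set_decode (popular_code x l (block k))) t = trunc (word_limit x (coloured_codes \<xi> i) l) t \<and>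
     \<not> popular x l (word_limit x (coloured_codes \<xi> i) l) (block k)"

definition cand :: "nat set \<Rightarrow> (nat \<Rightarrow> nat) \<Rightarrow> nat \<Rightarrow> nat \<Rightarrow> nat \<Rightarrow> nat \<Rightarrow> nat \<Rightarrow> bool" where
  "cand \<xi> x s i l t k \<longleftrightarrow> codes \<xi> (block k) \<and>
     (s = 0 \<and> cand_up x i k \<or> s = 1 \<and> cand_down x t k \<or> s = 2 \<and> cand_far x i t k \<or> s = 3 \<and> cand_near \<xi> x i l t k)"

text \<open>The kind, the colour and the length are packed into p, so that a single
  \<open>LEAST\<close> chooses all three; t is left free to grow along the selected points.\<close>

definition cand_mode :: "nat set \<Rightarrow> nat \<Rightarrow> nat \<Rightarrow> nat \<Rightarrow> bool" where
  "cand_mode \<xi> p t k \<longleftrightarrow> cand \<xi> (perm_of \<xi>) (fst (prod_decode p)) (fst (prod_decode (snd (prod_decode p))))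
     (snd (prod_decode (snd (prod_decode p)))) t k"

definition admissible :: "nat set \<Rightarrow> nat \<Rightarrow> bool" where
  "admissible \<xi> p \<longleftrightarrow> (\<forall>t b. \<exists>k. b < block k \<and> cand_mode \<xi> p t k)"

definition mode :: "nat set \<Rightarrow> nat" where
  "mode \<xi> = (LEAST p. admissible \<xi> p)"

text \<open>Both ends of each new arrow lie beyond all blocks used so far, so the surgeries of one
  generator live in separate blocks.\<close>

definition sel :: "nat set \<Rightarrow> nat \<Rightarrow> nat" where
  "sel \<xi> t = rec_nat (LEAST k. cand_mode \<xi> (mode \<xi>) 0 k)
     (\<lambda>t j. LEAST k. cand_mode \<xi> (mode \<xi>) (Suc t) k \<and>
        max (block j) (block (perm_of \<xi> j)) < min (block k) (block (perm_of \<xi> k))) t"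

text \<open>For \<open>surg \<xi> k q\<close>, the edges \<open>{k, base \<xi> k}\<close> and \<open>{q, base \<xi> q}\<close> of the base graph are replaced by \<open>{k, q}\<close>
  and \<open>{base \<xi> k, base \<xi> q}\<close>.\<close>

definition surg :: "nat set \<Rightarrow> nat \<Rightarrow> nat \<Rightarrow> bool" where
  "surg \<xi> k q \<longleftrightarrow> is_perm \<xi> \<and> (\<exists>p. admissible \<xi> p) \<and> (\<exists>t. k = sel \<xi> t) \<and> q = perm_of \<xi> k"

definition moved :: "nat set \<Rightarrow> nat \<Rightarrow> nat \<Rightarrow> nat \<Rightarrow> nat \<Rightarrow> bool" where
  "moved \<xi> k q a b \<longleftrightarrow> surg \<xi> k q \<and> (a = k \<and> b = q \<or> a = q \<and> b = k \<or>
     a = base \<xi> k \<and> b = base \<xi> q \<or> a = base \<xi> q \<and> b = base \<xi> k)"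

text \<open>\<open>LEAST\<close> merely names the partner of a, which is unique by
  \<open>moved_unique\<close>.\<close>

definition gen :: "nat set \<Rightarrow> nat \<Rightarrow> nat" where
  "gen \<xi> a = (if \<exists>k q b. moved \<xi> k q a b then LEAST b. \<exists>k q. moved \<xi> k q a b else base \<xi> a)"

lemma trunc_neq_mono: "trunc \<xi> m \<noteq> trunc \<eta> m \<Longrightarrow> m \<le> n \<Longrightarrow> trunc \<xi> n \<noteq> trunc \<eta> n"
proof (rule notI)
  assume *: "trunc \<xi> m \<noteq> trunc \<eta> m" "m \<le> n" "trunc \<xi> n = trunc \<eta> n"
  have "X \<inter> {..<m} = X \<inter> {..<n} \<inter> {..<m}" for X :: "nat set" using *(2) by auto
  then have "\<xi> \<inter> {..<m} = \<eta> \<inter> {..<m}" using *(3) unfolding trunc_eq_iff by metis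
  then show False using *(1) unfolding trunc_eq_iff by contradiction
qed

lemma trunc_eventually_neq:
  assumes "\<xi> \<noteq> \<eta>"
  obtains N where "\<And>n. N \<le> n \<Longrightarrow> trunc \<xi> n \<noteq> trunc \<eta> n"
proof -
  obtain i where "i \<in> \<xi> \<longleftrightarrow> i \<notin> \<eta>" using assms by blast
  then have "trunc \<xi> (Suc i) \<noteq> trunc \<eta> (Suc i)" unfolding trunc_eq_iff by blast
  then show ?thesis using that trunc_neq_mono by blast
qed

lemma codes_both_finite:
  assumes "\<xi> \<noteq> \<eta>"
  shows "finite {n. codes \<xi> n \<and> codes \<eta> n}"
proof -
  obtain N where N: "\<And>n. N \<le> n \<Longrightarrow> trunc \<xi> n \<noteq> trunc \<eta> n"
    using trunc_eventually_neq[OF assms] by blast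
  have "{n. codes \<xi> n \<and> codes \<eta> n} \<subseteq> node \<xi> ` {..<N}"
    using N by (fastforce simp: codes_def node_def prod_encode_eq not_less[symmetric])
  then show ?thesis using finite_surj by blast
qed

lemma coloured_codes_infinite: "infinite (coloured_codes \<xi> i)"
proof
  assume "finite (coloured_codes \<xi> i)"
  moreover have "node \<xi> (prod_encode (i, m)) \<in> coloured_codes \<xi> i" for m
    by (auto simp: coloured_codes_def codes_def node_def colour_def)
  then have "range (\<lambda>m. node \<xi> (prod_encode (i, m))) \<subseteq> coloured_codes \<xi> i" by blast
  ultimately have "finite (range (\<lambda>m. node \<xi> (prod_encode (i, m))))" using finite_subset by blast
  moreover have "inj (\<lambda>m. node \<xi> (prod_encode (i, m)))" by (auto simp: inj_def node_def prod_encode_eq)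
  ultimately show False using finite_imageD by blast
qed

lemma before_irrefl: "\<not> before n n"
  by (simp add: before_def)

lemma before_total: "before m n \<or> m = n \<or> before n m"
  by (auto simp: before_def)

lemma finite_blocks_less: "finite {a. block a < N}"
proof -
  have "{a. block a < N} = (\<Union>n<N. {a. block a = n})" by auto
  then show ?thesis by (simp add: finite_block)
qed

lemma cand_codes: "cand_mode \<xi> p t k \<Longrightarrow> codes \<xi> (block k)"
  by (simp add: cand_mode_def cand_def)

lemma sel_cand:
  assumes "is_perm \<xi>" "admissible \<xi> p"
  shows "cand_mode \<xi> (mode \<xi>) t (sel \<xi> t)"
    and "max (block (sel \<xi> t)) (block (perm_of \<xi> (sel \<xi> t)))
      < min (block (sel \<xi> (Suc t))) (block (perm_of \<xi> (sel \<xi> (Suc t))))"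
proof -
  have adm: "admissible \<xi> (mode \<xi>)" unfolding mode_def using assms(2) by (rule LeastI)
  have inj: "inj (perm_of \<xi>)" using assms(1) by (simp add: is_perm_def bij_is_inj)
  \<comment> \<open>By injectivity only finitely many points are mapped into low blocks, so a large
    enough bound on \<open>block k\<close> pushes the image up as well.\<close>
  have ex: "\<exists>k. cand_mode \<xi> (mode \<xi>) t k \<and> N < min (block k) (block (perm_of \<xi> k))" for t N
  proof -
    have "finite (perm_of \<xi> -` {a. block a < Suc N})"
      by (rule finite_vimageI[OF finite_blocks_less inj])
    then have "finite (block ` (perm_of \<xi> -` {a. block a < Suc N}))" by simp
    then obtain b where b: "\<And>k. block (perm_of \<xi> k) < Suc N \<Longrightarrow> block k \<le> b"
      by (auto simp: finite_nat_set_iff_bounded_le)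
    obtain k where "max b N < block k" "cand_mode \<xi> (mode \<xi>) t k"
      using adm unfolding admissible_def by blast
    moreover then have "N < block (perm_of \<xi> k)" using b[of k] by (cases "block (perm_of \<xi> k) < Suc N") auto
    ultimately show ?thesis by auto
  qed
  have step: "cand_mode \<xi> (mode \<xi>) (Suc t) (sel \<xi> (Suc t)) \<and>
      max (block (sel \<xi> t)) (block (perm_of \<xi> (sel \<xi> t)))
      < min (block (sel \<xi> (Suc t))) (block (perm_of \<xi> (sel \<xi> (Suc t))))" for t
    using LeastI_ex[OF ex[of "Suc t" "max (block (sel \<xi> t)) (block (perm_of \<xi> (sel \<xi> t)))"]]
    by (simp add: sel_def)
  have "cand_mode \<xi> (mode \<xi>) 0 (sel \<xi> 0)"
    using ex[of 0 0] unfolding sel_def by (auto intro: LeastI)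
  then show "cand_mode \<xi> (mode \<xi>) t (sel \<xi> t)" using step by (cases t) auto
  show "max (block (sel \<xi> t)) (block (perm_of \<xi> (sel \<xi> t)))
      < min (block (sel \<xi> (Suc t))) (block (perm_of \<xi> (sel \<xi> (Suc t))))" using step by blast
qed

lemma sel_mono:
  assumes "is_perm \<xi>" "admissible \<xi> p" "s < t"
  shows "max (block (sel \<xi> s)) (block (perm_of \<xi> (sel \<xi> s)))
      < min (block (sel \<xi> t)) (block (perm_of \<xi> (sel \<xi> t)))"
  using assms(3)
proof (induction t)
  case (Suc t)
  then show ?case using sel_cand(2)[OF assms(1,2), of t] by (cases "s = t") auto
qed simp

lemma sel_inj:
  assumes "is_perm \<xi>" "admissible \<xi> p"
  shows "inj (sel \<xi>)"
proof (rule injI)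
  fix s t assume "sel \<xi> s = sel \<xi> t"
  then show "s = t" using sel_mono[OF assms, of s t] sel_mono[OF assms, of t s]
    by (cases s t rule: linorder_cases) auto
qed

lemma surg_codes: "surg \<xi> k q \<Longrightarrow> codes \<xi> (block k)"
  unfolding surg_def using sel_cand(1) cand_codes by blast

lemma surg_disjoint:
  assumes "surg \<xi> k q" "surg \<xi> k' q'" "{block k, block q} \<inter> {block k', block q'} \<noteq> {}"
  shows "k = k'" "q = q'"
proof -
  obtain p s t where *: "is_perm \<xi>" "admissible \<xi> p" "k = sel \<xi> s" "q = perm_of \<xi> k" "k' = sel \<xi> t" "q' = perm_of \<xi> k'"
    using assms(1,2) unfolding surg_def by blast
  have "s = t" using assms(3) sel_mono[OF *(1,2), of s t] sel_mono[OF *(1,2), of t s] *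
    by (cases s t rule: linorder_cases) auto
  then show "k = k'" "q = q'" using * by auto
qed

lemma surg_infinite:
  assumes "is_perm \<xi>" "admissible \<xi> p"
  shows "infinite {k. surg \<xi> k (perm_of \<xi> k)}"
proof -
  have "range (sel \<xi>) \<subseteq> {k. surg \<xi> k (perm_of \<xi> k)}" using assms by (auto simp: surg_def)
  then show ?thesis using sel_inj[OF assms] finite_imageD finite_subset by blast
qed

lemma moved_sym: "moved \<xi> k q a b \<Longrightarrow> moved \<xi> k q b a"
  unfolding moved_def by blast

lemma moved_blocks: "moved \<xi> k q a b \<Longrightarrow> block a = block k \<and> block b = block q \<or> block a = block q \<and> block b = block k"
  unfolding moved_def by auto

text \<open>Both alterations come from the same surgery because they share a block. The clauses stay
  consistent in the degenerate cases q = k and q = \<open>base \<xi> k\<close>, as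
  \<open>base \<xi>\<close> is an involution without fixed points.\<close>

lemma moved_unique:
  assumes "moved \<xi> k q a b" "moved \<xi> k' q' a b'"
  shows "b = b'"
proof -
  have s: "surg \<xi> k q" "surg \<xi> k' q'" using assms by (auto simp: moved_def)
  have "{block k, block q} \<inter> {block k', block q'} \<noteq> {}"
    using moved_blocks[OF assms(1)] moved_blocks[OF assms(2)] by auto
  then have "k = k'" "q = q'" using surg_disjoint[OF s] by auto
  then show ?thesis using assms base_neq[of \<xi>] base_base[of \<xi>] unfolding moved_def by metis
qed

lemma gen_moved: "moved \<xi> k q a b \<Longrightarrow> gen \<xi> a = b"
  unfolding gen_def using moved_unique by (auto intro!: Least_equality) (metis order_refl)

lemma gen_cases: "(\<exists>k q. moved \<xi> k q a (gen \<xi> a)) \<or> gen \<xi> a = base \<xi> a \<and> (\<forall>k q b. \<not> moved \<xi> k q a b)"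
proof (cases "\<exists>k q b. moved \<xi> k q a b")
  case True
  then show ?thesis using gen_moved by metis
qed (auto simp: gen_def)

text \<open>A surgery touches whole edges of the base graph, so the untouched points are closed
  under the base action.\<close>

lemma not_moved_base: "(\<forall>k q b. \<not> moved \<xi> k q a b) \<Longrightarrow> \<not> moved \<xi> k q (base \<xi> a) b"
  unfolding moved_def by (metis base_base)

lemma gen_gen [simp]: "gen \<xi> (gen \<xi> a) = a"
proof (cases "\<exists>k q. moved \<xi> k q a (gen \<xi> a)")
  case True
  then show ?thesis using gen_moved moved_sym by blast
next
  case False
  then have *: "gen \<xi> a = base \<xi> a" "\<forall>k q b. \<not> moved \<xi> k q a b" using gen_cases by blast+
  then have "\<forall>k q b. \<not> moved \<xi> k q (base \<xi> a) b" using not_moved_base by blast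
  then have "gen \<xi> (base \<xi> a) = base \<xi> (base \<xi> a)" using gen_cases by blast
  then show ?thesis using * by simp
qed

lemma letters_length [simp]: "length (letters E l) = l"
  by (simp add: letters_def)

lemma reduced_at_iff: "reduced_at n E l \<longleftrightarrow> distinct_adj (map (\<lambda>\<xi>. trunc \<xi> n) (letters E l))"
  by (auto simp: reduced_at_def distinct_adj_conv_nth letters_def)

definition word_set :: "nat set list \<Rightarrow> nat set" where
  "word_set w = {c. fst (prod_decode c) < length w \<and> snd (prod_decode c) \<in> w ! fst (prod_decode c)}"

lemma sect_word_set: "j < length w \<Longrightarrow> sect (word_set w) j = w ! j"
  by (auto simp: sect_def word_set_def)

lemma letters_word_set [simp]: "letters (word_set w) (length w) = w"
  by (rule nth_equalityI) (auto simp: letters_def sect_word_set)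

text \<open>Only elements below n matter in block n, so every letter can be cut down to a finite
  set. Hence a quantifier over numbers z covers all words there.\<close>

lemma code_of_word:
  obtains z where "map (\<lambda>\<xi>. trunc \<xi> n) (letters (set_decode z) (length w)) = map (\<lambda>\<xi>. trunc \<xi> n) w"
proof -
  define Z where "Z = {c \<in> word_set w. snd (prod_decode c) < n}"
  have "Z \<subseteq> prod_encode ` ({..<length w} \<times> {..<n})"
  proof
    fix c assume "c \<in> Z"
    then show "c \<in> prod_encode ` ({..<length w} \<times> {..<n})"
      by (intro image_eqI[of c prod_encode "prod_decode c"]) (simp_all add: Z_def word_set_def mem_Times_iff)
  qed
  then have Z: "finite Z" by (rule finite_subset) simp
  have "sect Z j \<inter> {..<n} = w ! j \<inter> {..<n}" if "j < length w" for j
    using that by (auto simp: sect_def Z_def word_set_def)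
  then have "map (\<lambda>\<xi>. trunc \<xi> n) (letters Z (length w)) = map (\<lambda>\<xi>. trunc \<xi> n) w"
    by (intro nth_equalityI) (auto simp: letters_def trunc_eq_iff)
  then show ?thesis using that[of "set_encode Z"] Z by simp
qed

lemma distinct_adj_eventually_trunc:
  assumes "distinct_adj w"
  obtains N where "\<And>n. N \<le> n \<Longrightarrow> distinct_adj (map (\<lambda>\<xi>. trunc \<xi> n) w)"
proof -
  have "\<exists>N. \<forall>n\<ge>N. distinct_adj (map (\<lambda>\<xi>. trunc \<xi> n) w)" using assms
  proof (induction w rule: induct_list012)
    case (3 \<xi> \<eta> w)
    then obtain N where "\<forall>n\<ge>N. distinct_adj (map (\<lambda>\<xi>. trunc \<xi> n) (\<eta> # w))" by auto
    moreover obtain M where "\<And>n. M \<le> n \<Longrightarrow> trunc \<xi> n \<noteq> trunc \<eta> n"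
      using 3 trunc_eventually_neq[of \<xi> \<eta>] by auto
    ultimately show ?case by (intro exI[of _ "max M N"]) auto
  qed auto
  then show ?thesis using that by blast
qed

section \<open>Cofinitarity\<close>

lemma trunc_Suc: "trunc X (Suc b) = trunc X b + (if b \<in> X then 2 ^ b else 0)"
proof -
  have "X \<inter> {..<Suc b} = (if b \<in> X then insert b (X \<inter> {..<b}) else X \<inter> {..<b})"
    by (auto simp: less_Suc_eq)
  then show ?thesis unfolding trunc_def by (simp add: set_encode_insert)
qed

lemma trunc_eqD:
  assumes "trunc X n = trunc Y n" "i < n"
  shows "i \<in> X \<longleftrightarrow> i \<in> Y"
proof -
  have "i \<in> X \<inter> {..<n} \<longleftrightarrow> i \<in> Y \<inter> {..<n}" using assms(1) unfolding trunc_eq_iff by simp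
  then show ?thesis using assms(2) by simp
qed

lemma limit_code_eq: "limit_code E A b = trunc (limit_set E A) b"
proof (induction b)
  case 0
  then show ?case by (simp add: limit_code_def trunc_def)
next
  case (Suc b)
  have "limit_code E A (Suc b) =
    (if infinite {n \<in> A. trunc (E n) (Suc b) = limit_code E A b} then limit_code E A b else limit_code E A b + 2 ^ b)"
    by (simp add: limit_code_def)
  then show ?case using Suc by (simp add: trunc_Suc limit_set_def)
qed

text \<open>Of the infinitely many sets agreeing so far, infinitely many have the next bit unset or
  infinitely many have it set; the limit takes the second option only if the first fails.\<close>

lemma limit_set_accum:
  assumes "infinite A"
  shows "infinite {n \<in> A. trunc (E n) b = trunc (limit_set E A) b}"
proof (induction b)
  case 0
  then show ?case using assms by (simp add: trunc_def)
next
  case (Suc b)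
  let ?t = "trunc (limit_set E A) b"
  have "{n \<in> A. trunc (E n) b = ?t}
    \<subseteq> {n \<in> A. trunc (E n) (Suc b) = ?t} \<union> {n \<in> A. trunc (E n) (Suc b) = ?t + 2 ^ b}"
    by (auto simp: trunc_Suc)
  then have "infinite {n \<in> A. trunc (E n) (Suc b) = ?t} \<or> infinite {n \<in> A. trunc (E n) (Suc b) = ?t + 2 ^ b}"
    using Suc by (meson finite_UnI finite_subset)
  moreover have "b \<in> limit_set E A \<longleftrightarrow> finite {n \<in> A. trunc (E n) (Suc b) = ?t}"
    unfolding limit_code_eq[symmetric] by (simp add: limit_set_def)
  ultimately show ?case by (auto simp: trunc_Suc[of "limit_set E A"])
qed

lemma before_asym: "before m n \<Longrightarrow> \<not> before n m"
  by (auto simp: before_def)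

lemma surg_selE:
  assumes "surg \<xi> k q"
  obtains t where "k = sel \<xi> t" "q = perm_of \<xi> k" "cand_mode \<xi> (mode \<xi>) t k"
  using assms sel_cand(1) unfolding surg_def by blast

lemma sel_block_ge:
  assumes "is_perm \<xi>" "admissible \<xi> p"
  shows "t \<le> block (sel \<xi> t)"
proof (induction t)
  case (Suc t)
  then show ?case using sel_cand(2)[OF assms, of t] by auto
qed simp

text \<open>All surgeries of \<xi> share one mode, and a single up arrow reveals its kind, because
  the other kinds go down or stay.\<close>

lemma surg_up_colour:
  assumes "surg \<xi> k q" "before (block k) (block q)"
  obtains i where "\<And>k' q'. surg \<xi> k' q' \<Longrightarrow> colour (block k') = i"
proof -
  let ?s = "fst (prod_decode (mode \<xi>))" and ?i = "fst (prod_decode (snd (prod_decode (mode \<xi>))))"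
  have s: "?s = 0" using assms before_asym[OF assms(2)] before_irrefl
    by (auto elim!: surg_selE simp: cand_mode_def cand_def cand_down_def cand_far_def cand_near_def)
  have "colour (block k') = ?i" if k': "surg \<xi> k' q'" for k' q'
    using k' s by (auto elim!: surg_selE simp: cand_mode_def cand_def cand_up_def)
  then show ?thesis using that by blast
qed

text \<open>The mode is the downward one, where the t-th selected point has colour at least
  t.\<close>

lemma surg_down_finite:
  assumes "surg \<xi> k q" "before (block q) (block k)"
  shows "finite {k'. (\<exists>q'. surg \<xi> k' q') \<and> colour (block k') \<le> c}"
proof -
  have s: "fst (prod_decode (mode \<xi>)) = 1" using assms before_asym[OF assms(2)] before_irrefl
    by (auto elim!: surg_selE simp: cand_mode_def cand_def cand_up_def cand_far_def cand_near_def)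
  have "k' \<in> sel \<xi> ` {..c}" if "surg \<xi> k' q'" "colour (block k') \<le> c" for k' q'
    using that(1)
  proof (rule surg_selE)
    fix t assume t: "k' = sel \<xi> t" "cand_mode \<xi> (mode \<xi>) t k'"
    then have "t \<le> colour (block k')" using s by (auto simp: cand_mode_def cand_def cand_down_def)
    then show ?thesis using t(1) that(2) by auto
  qed
  then have "{k'. (\<exists>q'. surg \<xi> k' q') \<and> colour (block k') \<le> c} \<subseteq> sel \<xi> ` {..c}" by blast
  then show ?thesis using finite_subset by blast
qed

lemma popular_cong:
  assumes "map (\<lambda>\<xi>. trunc \<xi> n) (letters E l) = map (\<lambda>\<xi>. trunc \<xi> n) (letters E' l)"
  shows "popular x l E n \<longleftrightarrow> popular x l E' n"
proof -
  have "fold base (letters E l) k = fold base (letters E' l) k" if "block k = n" for k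
    using assms that by (intro fold_base_cong) simp
  then have "{k. block k = n \<and> fold base (letters E l) k = x k} = {k. block k = n \<and> fold base (letters E' l) k = x k}"
    by auto
  then show ?thesis using assms unfolding popular_def reduced_at_iff by simp
qed

text \<open>Whether i belongs to the j-th letter is decided at any stage t beyond both i and the
  code of (j, i).\<close>

lemma limit_letters:
  assumes "infinite T"
    and "\<And>t. t \<in> T \<Longrightarrow> t \<le> n t"
    and "\<And>t. t \<in> T \<Longrightarrow> map (\<lambda>\<xi>. trunc \<xi> (n t)) (letters (E t) l) = map (\<lambda>\<xi>. trunc \<xi> (n t)) w"
    and "\<And>t. t \<in> T \<Longrightarrow> trunc (E t) t = trunc W t"
  shows "letters W l = w"
proof (rule nth_equalityI)
  obtain t where t: "t \<in> T" using assms(1) by (metis all_not_in_conv finite.emptyI)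
  show len: "length (letters W l) = length w" using arg_cong[OF assms(3)[OF t], of length] by simp
  fix j assume "j < length (letters W l)"
  then have j: "j < l" "j < length w" using len by auto
  have "i \<in> sect W j \<longleftrightarrow> i \<in> w ! j" for i
  proof -
    obtain t where t: "t \<in> T" "max i (prod_encode (j, i)) < t" using assms(1) unfolding infinite_nat_iff_unbounded by blast
    have "trunc (sect (E t) j) (n t) = trunc (w ! j) (n t)"
      using arg_cong[OF assms(3)[OF t(1)], of "\<lambda>xs. xs ! j"] j by (simp add: letters_def)
    then have "i \<in> sect (E t) j \<longleftrightarrow> i \<in> w ! j"
      using assms(2)[OF t(1)] t(2) by (intro trunc_eqD) auto
    moreover have "prod_encode (j, i) \<in> E t \<longleftrightarrow> prod_encode (j, i) \<in> W"
      using assms(4)[OF t(1)] t(2) by (intro trunc_eqD) auto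
    ultimately show ?thesis by (simp add: sect_def)
  qed
  then show "letters W l ! j = w ! j" using j by (auto simp: letters_def)
qed

text \<open>For the third kind, the condition at stages t beyond the length of w rules out w itself.
  For the fourth kind, infinitely many coincidences would, by uniqueness of base paths, make the
  popular words equal to w in those blocks; then the limit has the letters w and is popular there,
  contrary to the choice of the points.\<close>

lemma surg_stay_finite:
  assumes "surg \<xi> k q" "block q = block k" "distinct_adj w"
  shows "finite {k'. \<exists>q'. surg \<xi> k' q' \<and> fold base w k' = q'}"
proof -
  let ?s = "fst (prod_decode (mode \<xi>))" and ?i = "fst (prod_decode (snd (prod_decode (mode \<xi>))))"
    and ?l = "snd (prod_decode (snd (prod_decode (mode \<xi>))))"
  let ?x = "perm_of \<xi>"
  define T where "T = {t. fold base w (sel \<xi> t) = ?x (sel \<xi> t)}"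
  have s: "?s = 2 \<or> ?s = 3" using assms before_irrefl
    by (auto elim!: surg_selE simp: cand_mode_def cand_def cand_up_def cand_down_def)
  obtain p where p: "is_perm \<xi>" "admissible \<xi> p" using assms(1) unfolding surg_def by blast
  have c: "cand_mode \<xi> (mode \<xi>) t (sel \<xi> t)" for t using sel_cand(1)[OF p] .
  obtain N where N: "\<And>n. N \<le> n \<Longrightarrow> distinct_adj (map (\<lambda>\<xi>. trunc \<xi> n) w)"
    using distinct_adj_eventually_trunc[OF assms(3)] by blast
  have "finite T"
  proof (cases "?s = 2")
    case True
    have "t < max N (length w)" if "t \<in> T" for t
    proof (rule ccontr)
      assume "\<not> t < max N (length w)"
      then have t: "N \<le> t" "length w \<le> t" by auto
      let ?n = "block (sel \<xi> t)"
      have n: "N \<le> ?n" using t(1) sel_block_ge[OF p, of t] by simp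
      obtain z where z: "map (\<lambda>\<xi>. trunc \<xi> ?n) (letters (set_decode z) (length w)) = map (\<lambda>\<xi>. trunc \<xi> ?n) w"
        using code_of_word by blast
      have "reduced_at ?n (set_decode z) (length w)" unfolding reduced_at_iff z by (rule N[OF n])
      then have "fold base (letters (set_decode z) (length w)) (sel \<xi> t) \<noteq> ?x (sel \<xi> t)"
        using c[of t] True t(2) by (auto simp: cand_mode_def cand_def cand_far_def)
      then show False using fold_base_cong[OF z] that by (simp add: T_def)
    qed
    then show ?thesis using bounded_nat_set_is_finite by blast
  next
    case False
    then have s3: "?s = 3" using s by simp
    let ?n = "\<lambda>t. block (sel \<xi> t)" and ?W = "word_limit ?x (coloured_codes \<xi> ?i) ?l"
    let ?E = "\<lambda>t. set_decode (popular_code ?x ?l (?n t))"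
    have near: "popular ?x ?l (?E t) (?n t)" "fold base (letters (?E t) ?l) (sel \<xi> t) = ?x (sel \<xi> t)"
      "trunc (?E t) t = trunc ?W t" "\<not> popular ?x ?l ?W (?n t)" for t
      using c[of t] s3 by (auto simp: cand_mode_def cand_def cand_near_def)
    show ?thesis
    proof (rule ccontr)
      assume inf: "infinite T"
      define T' where "T' = T - {..<max N (?l + length w)}"
      have inf': "infinite T'" using inf by (auto simp: T'_def)
      have eq: "map (\<lambda>\<xi>. trunc \<xi> (?n t)) (letters (?E t) ?l) = map (\<lambda>\<xi>. trunc \<xi> (?n t)) w" if "t \<in> T'" for t
      proof (rule base_path_unique)
        have t: "t \<in> T" "N \<le> ?n t" "?l + length w \<le> ?n t"
          using that sel_block_ge[OF p, of t] by (auto simp: T'_def)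
        show "fold base (letters (?E t) ?l) (sel \<xi> t) = fold base w (sel \<xi> t)"
          using near(2) t(1) by (simp add: T_def)
        show "distinct_adj (map (\<lambda>\<xi>. trunc \<xi> (?n t)) (letters (?E t) ?l))"
          using near(1)[of t] unfolding popular_def reduced_at_iff by blast
        show "distinct_adj (map (\<lambda>\<xi>. trunc \<xi> (?n t)) w)" using N t(2) .
        show "length (letters (?E t) ?l) + length w \<le> ?n t" using t(3) by simp
      qed
      have W: "letters ?W ?l = w"
        by (rule limit_letters[OF inf' sel_block_ge[OF p] eq near(3)])
      obtain t where t: "t \<in> T'" using inf' by (metis all_not_in_conv finite.emptyI)
      have "popular ?x ?l ?W (?n t)"
        using popular_cong[of "?n t" "?E t" ?l ?W ?x] eq[OF t] near(1)[of t] W by simp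
      then show False using near(4) by blast
    qed
  qed
  moreover have "{k'. \<exists>q'. surg \<xi> k' q' \<and> fold base w k' = q'} \<subseteq> sel \<xi> ` T"
    by (auto simp: surg_def T_def)
  ultimately show ?thesis by (meson finite_surj)
qed

text \<open>The bound \<open>Suc l\<close> leaves room for fewer than l letters with one more letter
  added at either end.\<close>

definition good_block :: "nat set set \<Rightarrow> nat \<Rightarrow> nat \<Rightarrow> bool" where
  "good_block F l n \<longleftrightarrow> l < n \<and>
     (\<forall>\<xi>\<in>F. \<forall>\<eta>\<in>F. \<xi> \<noteq> \<eta> \<longrightarrow> trunc \<xi> n \<noteq> trunc \<eta> n) \<and>
     (\<forall>\<xi>\<in>F. \<forall>\<eta>\<in>F. \<xi> \<noteq> \<eta> \<longrightarrow> \<not> (codes \<xi> n \<and> codes \<eta> n)) \<and>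
     (\<forall>\<xi>\<in>F. \<forall>\<eta>\<in>F. \<not> (\<exists>k q k' q'. surg \<xi> k q \<and> before (block k) (block q) \<and>
        surg \<eta> k' q' \<and> before (block q') (block k') \<and> block k' = n \<and> block q = n)) \<and>
     (\<forall>\<xi>\<in>F. \<forall>w\<in>{w. set w \<subseteq> F \<and> length w \<le> Suc l}. distinct_adj w \<longrightarrow>
        \<not> (\<exists>k q. surg \<xi> k q \<and> block k = n \<and> block q = n \<and> fold base w k = q))"

lemma good_block_eventually:
  assumes "finite F"
  shows "\<forall>\<^sub>F n in sequentially. good_block F l n"
proof -
  have cof: "finite {n. \<not> P n} \<Longrightarrow> \<forall>\<^sub>F n in sequentially. P n" for P :: "nat \<Rightarrow> bool"
    by (simp add: eventually_cofinite cofinite_eq_sequentially[symmetric])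
  have ev1: "\<forall>\<^sub>F n in sequentially. \<xi> \<noteq> \<eta> \<longrightarrow> trunc \<xi> n \<noteq> trunc \<eta> n" for \<xi> \<eta>
  proof (cases "\<xi> = \<eta>")
    case False
    then obtain N where "\<And>n. N \<le> n \<Longrightarrow> trunc \<xi> n \<noteq> trunc \<eta> n" by (rule trunc_eventually_neq) blast
    then show ?thesis by (intro eventually_sequentiallyI[of N]) simp
  qed simp
  have ev2: "\<forall>\<^sub>F n in sequentially. \<xi> \<noteq> \<eta> \<longrightarrow> \<not> (codes \<xi> n \<and> codes \<eta> n)" for \<xi> \<eta>
    using codes_both_finite[of \<xi> \<eta>] by (cases "\<xi> = \<eta>") (auto intro: cof)
  \<comment> \<open>All surgeries of an upward \<xi> start in one colour i and end in colours at
    most i; those of a downward \<eta> start only finitely often in such colours.\<close>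
  have ev3: "\<forall>\<^sub>F n in sequentially. \<not> (\<exists>k q k' q'. surg \<xi> k q \<and> before (block k) (block q) \<and>
        surg \<eta> k' q' \<and> before (block q') (block k') \<and> block k' = n \<and> block q = n)" for \<xi> \<eta>
  proof (rule cof, unfold not_not)
    let ?A = "{n. \<exists>k q k' q'. surg \<xi> k q \<and> before (block k) (block q) \<and>
        surg \<eta> k' q' \<and> before (block q') (block k') \<and> block k' = n \<and> block q = n}"
    show "finite ?A"
    proof (cases "?A = {}")
      case False
      then obtain k q k' q' where "surg \<xi> k q" "before (block k) (block q)"
        and down: "surg \<eta> k' q'" "before (block q') (block k')" by blast
      then obtain i where i: "\<And>k' q'. surg \<xi> k' q' \<Longrightarrow> colour (block k') = i"
        using surg_up_colour by blast
      have "?A \<subseteq> block ` {k'. (\<exists>q'. surg \<eta> k' q') \<and> colour (block k') \<le> i}"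
      proof
        fix n assume "n \<in> ?A"
        then obtain k q k' q' where *: "surg \<xi> k q" "before (block k) (block q)"
          "surg \<eta> k' q'" "block k' = n" "block q = n" by blast
        then have "colour n \<le> i" using i[OF *(1)] by (auto simp: before_def)
        then show "n \<in> block ` {k'. (\<exists>q'. surg \<eta> k' q') \<and> colour (block k') \<le> i}" using * by blast
      qed
      then show ?thesis using surg_down_finite[OF down] by (rule finite_surj[rotated])
    next
      case True
      then show ?thesis by (metis finite.emptyI)
    qed
  qed
  have ev4: "\<forall>\<^sub>F n in sequentially. distinct_adj w \<longrightarrow>
      \<not> (\<exists>k q. surg \<xi> k q \<and> block k = n \<and> block q = n \<and> fold base w k = q)" for \<xi> w
  proof (cases "distinct_adj w \<and> (\<exists>k q. surg \<xi> k q \<and> block q = block k)")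
    case True
    then have "finite {k'. \<exists>q'. surg \<xi> k' q' \<and> fold base w k' = q'}" using surg_stay_finite by blast
    then have "finite (block ` {k'. \<exists>q'. surg \<xi> k' q' \<and> fold base w k' = q'})" by simp
    then show ?thesis using True by (intro cof) (auto elim!: finite_subset[rotated])
  next
    case False
    then show ?thesis by (intro always_eventually) metis
  qed
  have finW: "finite {w. set w \<subseteq> F \<and> length w \<le> Suc l}" using assms by (rule finite_lists_length_le)
  show ?thesis
    unfolding good_block_def
    by (intro eventually_conj eventually_gt_at_top eventually_ball_finite assms finW ballI ev1 ev2 ev3 ev4)
qed


lemma
  assumes "good_block F l n"
  shows good_block_gt: "l < n"
    and good_block_trunc: "\<xi> \<in> F \<Longrightarrow> \<eta> \<in> F \<Longrightarrow> \<xi> \<noteq> \<eta> \<Longrightarrow> trunc \<xi> n \<noteq> trunc \<eta> n"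
    and good_block_codes: "\<xi> \<in> F \<Longrightarrow> \<eta> \<in> F \<Longrightarrow> codes \<xi> n \<Longrightarrow> codes \<eta> n \<Longrightarrow> \<xi> = \<eta>"
    and good_block_up_down: "\<xi> \<in> F \<Longrightarrow> \<eta> \<in> F \<Longrightarrow> surg \<xi> k q \<Longrightarrow> before (block k) (block q) \<Longrightarrow>
      surg \<eta> k' q' \<Longrightarrow> before (block q') (block k') \<Longrightarrow> block k' = n \<Longrightarrow> block q \<noteq> n"
    and good_block_stay: "\<xi> \<in> F \<Longrightarrow> set w \<subseteq> F \<Longrightarrow> length w \<le> Suc l \<Longrightarrow> distinct_adj w \<Longrightarrow>
      surg \<xi> k q \<Longrightarrow> block k = n \<Longrightarrow> block q = n \<Longrightarrow> fold base w k \<noteq> q"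
proof -
  note * = assms[unfolded good_block_def]
  show "l < n" by (rule conjunct1[OF *])
  note * = conjunct2[OF *]
  show "trunc \<xi> n \<noteq> trunc \<eta> n" if "\<xi> \<in> F" "\<eta> \<in> F" "\<xi> \<noteq> \<eta>"
    using conjunct1[OF *, rule_format, OF that] .
  note * = conjunct2[OF *]
  show "\<xi> = \<eta>" if "\<xi> \<in> F" "\<eta> \<in> F" "codes \<xi> n" "codes \<eta> n"
    using conjunct1[OF *, rule_format, OF that(1,2)] that(3,4) by auto
  note * = conjunct2[OF *]
  show "block q \<noteq> n" if "\<xi> \<in> F" "\<eta> \<in> F" "surg \<xi> k q" "before (block k) (block q)"
    "surg \<eta> k' q'" "before (block q') (block k')" "block k' = n"
  proof
    assume "block q = n"
    then show False using conjunct1[OF *, rule_format, OF that(1,2)] that(3-) by metis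
  qed
  note * = conjunct2[OF *]
  show "fold base w k \<noteq> q" if "\<xi> \<in> F" "set w \<subseteq> F" "length w \<le> Suc l" "distinct_adj w"
      "surg \<xi> k q" "block k = n" "block q = n"
  proof
    assume "fold base w k = q"
    moreover have "w \<in> {w. set w \<subseteq> F \<and> length w \<le> Suc l}" using that(2,3) by simp
    ultimately show False using *[rule_format, OF that(1) _ that(4)] that(5-) by metis
  qed
qed

section \<open>Closed walks in good blocks\<close>

lemma distinct_adj_map_upt:
  assumes "\<And>m. i \<le> m \<Longrightarrow> Suc m < j \<Longrightarrow> f m \<noteq> f (Suc m)"
  shows "distinct_adj (map f [i..<j])"
  unfolding distinct_adj_conv_nth using assms by (auto simp: less_diff_conv)

lemma fold_walk:
  assumes "i \<le> j" "\<And>m. i \<le> m \<Longrightarrow> m < j \<Longrightarrow> a (Suc m) = g (X m) (a m)"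
  shows "fold g (map X [i..<j]) (a i) = a j"
  using assms
proof (induction "j - i" arbitrary: i)
  case (Suc d)
  then have "fold g (map X [Suc i..<j]) (a (Suc i)) = a j" by (intro Suc(1)) auto
  moreover have "a (Suc i) = g (X i) (a i)" using Suc by auto
  ultimately show ?case using Suc(2) by (simp add: upt_conv_Cons)
qed simp

text \<open>A closed reduced walk cannot stay in good blocks. If it crosses between blocks, then the blocks
  that are sources of crossing surgeries have an extremal member which is left and entered only through
  one surgery; between entering and leaving, the walk would close a short cycle of the base graph.\<close>

locale closed_walk =
  fixes a :: "nat \<Rightarrow> nat" and \<Xi> :: "nat \<Rightarrow> nat set" and l :: nat
  assumes l: "0 < l" and a_per: "\<And>i. a (i + l) = a i" and Xi_per: "\<And>i. \<Xi> (i + l) = \<Xi> i"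
    and step: "\<And>i. a (Suc i) = gen (\<Xi> i) (a i)"
    and red: "\<And>i. \<Xi> (Suc i) \<noteq> \<Xi> i"
    and good: "\<And>i. good_block (range \<Xi>) l (block (a i))"
begin

lemma trunc_neq: "\<xi> \<in> range \<Xi> \<Longrightarrow> \<eta> \<in> range \<Xi> \<Longrightarrow> \<xi> \<noteq> \<eta> \<Longrightarrow> trunc \<xi> (block (a i)) \<noteq> trunc \<eta> (block (a i))"
  by (rule good_block_trunc[OF good])

lemma codes_unique: "codes (\<Xi> m) (block (a i)) \<Longrightarrow> codes (\<Xi> m') (block (a i)) \<Longrightarrow> \<Xi> m = \<Xi> m'"
  by (rule good_block_codes[OF good]) auto

lemma distinct_adj_trunc:
  "set w \<subseteq> range \<Xi> \<Longrightarrow> distinct_adj w \<Longrightarrow> distinct_adj (map (\<lambda>\<xi>. trunc \<xi> (block (a i))) w)"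
  using trunc_neq by (induction w rule: induct_list012) auto

lemma girth:
  assumes "set w \<subseteq> range \<Xi>" "distinct_adj w" "w \<noteq> []" "length w \<le> Suc l"
  shows "fold base w (a i) \<noteq> a i"
proof (rule base_girth)
  show "length w \<le> Suc (block (a i))" using assms(4) good_block_gt[OF good, of i] by linarith
qed (use assms distinct_adj_trunc in auto)

definition surgical :: "nat \<Rightarrow> bool" where
  "surgical i \<longleftrightarrow> a (Suc i) \<noteq> base (\<Xi> i) (a i)"

lemma surgicalE:
  assumes "surgical i"
  obtains k q where "moved (\<Xi> i) k q (a i) (a (Suc i))"
  using assms gen_cases[of "\<Xi> i" "a i"] step[of i] unfolding surgical_def by metis

lemma surgical_per: "surgical (i + l) = surgical i"
  using a_per[of i] a_per[of "Suc i"] Xi_per[of i] by (simp add: surgical_def)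

text \<open>Neighbouring letters differ, so between two surgical steps with the letter \<xi> there
  is a nonempty base path that neither begins nor ends with \<xi>. By girth it cannot return to its
  starting point, nor to the neighbour of that point under \<open>base \<xi>\<close>. The case j = i
  + l is the same step one period later.\<close>

lemma segment:
  assumes ij: "i < j" "j \<le> i + l" and X: "\<Xi> i = \<xi>" "\<Xi> j = \<xi>"
    and between: "\<And>m. i < m \<Longrightarrow> m < j \<Longrightarrow> \<not> surgical m"
  obtains w where "fold base w (a (Suc i)) = a j" "w \<noteq> []" "hd w \<noteq> \<xi>" "last w \<noteq> \<xi>"
    "distinct_adj w" "set w \<subseteq> range \<Xi>" "length w < l" "a j \<noteq> a (Suc i)" "a j \<noteq> base \<xi> (a (Suc i))"
proof -
  have "j \<noteq> Suc i" using red[of i] X by auto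
  then have ij': "Suc i < j" using ij by simp
  define w where "w = map \<Xi> [Suc i..<j]"
  have fold_w: "fold base w (a (Suc i)) = a j"
    unfolding w_def by (rule fold_walk) (use ij between in \<open>auto simp: surgical_def\<close>)
  have w: "w \<noteq> []" "hd w \<noteq> \<xi>" "distinct_adj w" "set w \<subseteq> range \<Xi>" "length w < l"
    using ij ij' red[of i] X red unfolding w_def
    by (auto simp: hd_map intro!: distinct_adj_map_upt)
  have lw: "last w \<noteq> \<xi>"
    using ij' red[of "j - 1"] X(2) unfolding w_def by (simp add: last_map)
  have n1: "a j \<noteq> a (Suc i)" using girth[OF w(4,3,1), of "Suc i"] w(5) fold_w by simp
  have n2: "a j \<noteq> base \<xi> (a (Suc i))"
  proof
    assume "a j = base \<xi> (a (Suc i))"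
    then have "fold base (w @ [\<xi>]) (a (Suc i)) = a (Suc i)" using fold_w by simp
    moreover have "fold base (w @ [\<xi>]) (a (Suc i)) \<noteq> a (Suc i)"
      using w lw X by (intro girth) (auto simp: distinct_adj_append_iff)
    ultimately show False by contradiction
  qed
  show ?thesis by (rule that[OF fold_w w(1,2) lw w(3,4,5) n1 n2])
qed

lemma surgical_exists: "\<exists>i. surgical i"
proof (rule ccontr)
  assume "\<not> ?thesis"
  then have "fold base (map \<Xi> [0..<l]) (a 0) = a l"
    by (intro fold_walk) (auto simp: surgical_def)
  then have "fold base (map \<Xi> [0..<l]) (a 0) = a 0" using a_per[of 0] by simp
  moreover have "fold base (map \<Xi> [0..<l]) (a 0) \<noteq> a 0"
    using l red by (intro girth distinct_adj_map_upt) auto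
  ultimately show False by contradiction
qed

definition crossing :: "nat \<Rightarrow> bool" where
  "crossing i \<longleftrightarrow> block (a (Suc i)) \<noteq> block (a i)"

lemma crossing_surgical: "crossing i \<Longrightarrow> surgical i"
  unfolding crossing_def surgical_def by auto

text \<open>All surgical steps lie in one block, so they belong to one generator and to one surgery
  on k and q. Up to the next surgical step the walk is a base path which, by \<open>segment\<close>,
  cannot return to the base edge it left; so it joins the edge of k to the edge of q, contrary to
  \<open>good_block_stay\<close>.\<close>

lemma no_crossing_impossible:
  assumes "\<And>i. \<not> crossing i"
  shows False
proof -
  have const: "block (a i) = block (a 0)" for i
    using assms by (induction i) (auto simp: crossing_def)
  define B where "B = block (a 0)"
  obtain i where i: "surgical i" using surgical_exists by blast
  then obtain k q where kq: "moved (\<Xi> i) k q (a i) (a (Suc i))" by (rule surgicalE)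
  have s: "surg (\<Xi> i) k q" using kq by (simp add: moved_def)
  have b: "block k = B" "block q = B"
    using moved_blocks[OF kq] const[of i] const[of "Suc i"] by (auto simp: B_def)
  define P where "P d = surgical (Suc i + d)" for d
  have "P (l - 1)" using i surgical_per[of i] l unfolding P_def by simp
  then have "P (LEAST d. P d)" "(LEAST d. P d) \<le> l - 1" by (auto intro: LeastI Least_le)
  then obtain d where d: "P d" "d \<le> l - 1" "\<And>m. m < d \<Longrightarrow> \<not> P m" using not_less_Least by metis
  define j where "j = Suc i + d"
  have j: "i < j" "j \<le> i + l" "surgical j" using d l by (auto simp: j_def P_def)
  have between: "\<not> surgical m" if "i < m" "m < j" for m
    using d(3)[of "m - Suc i"] that by (auto simp: P_def j_def)
  obtain k' q' where kq': "moved (\<Xi> j) k' q' (a j) (a (Suc j))" using j(3) by (rule surgicalE)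
  then have s': "surg (\<Xi> j) k' q'" by (simp add: moved_def)
  have b': "block k' = B" using moved_blocks[OF kq'] const[of j] const[of "Suc j"] by (auto simp: B_def)
  have X: "\<Xi> j = \<Xi> i" using codes_unique[of j 0 i] surg_codes[OF s] surg_codes[OF s'] b b' by (simp add: B_def)
  have "k' = k" "q' = q" using surg_disjoint[of "\<Xi> i" k' q' k q] s s' b b' X by auto
  then have kq': "moved (\<Xi> i) k q (a j) (a (Suc j))" using kq' X by simp
  let ?\<xi> = "\<Xi> i"
  obtain w where w: "fold base w (a (Suc i)) = a j" "w \<noteq> []" "hd w \<noteq> ?\<xi>" "last w \<noteq> ?\<xi>"
    "distinct_adj w" "set w \<subseteq> range \<Xi>" "length w < l" "a j \<noteq> a (Suc i)" "a j \<noteq> base ?\<xi> (a (Suc i))"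
    by (rule segment[OF j(1,2) refl X between])
  have no_path: False if p: "p = k \<or> p = base ?\<xi> k" "p' = q \<or> p' = base ?\<xi> q"
    and v: "fold base v p = p'" "v \<noteq> []" "hd v \<noteq> ?\<xi>" "last v \<noteq> ?\<xi>" "distinct_adj v" "set v \<subseteq> range \<Xi>"
      "length v < l" for p p' v
  proof -
    \<comment> \<open>An added letter \<xi> passes from k to its base neighbour, or from the base
      neighbour of q to q.\<close>
    define u where "u = (if p = k then [] else [?\<xi>]) @ v @ (if p' = q then [] else [?\<xi>])"
    have "fold base u k = q" using p v(1) by (auto simp: u_def)
    moreover have "distinct_adj u" using v by (auto simp: u_def distinct_adj_append_iff distinct_adj_Cons)
    moreover have "set u \<subseteq> range \<Xi>" "length u \<le> Suc l" using v by (auto simp: u_def)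
    ultimately show False using good_block_stay[OF good[of 0] _ _ _ _ s] b unfolding B_def by blast
  qed
  have pts: "a (Suc i) = k \<or> a (Suc i) = base ?\<xi> k \<or> a (Suc i) = q \<or> a (Suc i) = base ?\<xi> q"
    "a j = k \<or> a j = base ?\<xi> k \<or> a j = q \<or> a j = base ?\<xi> q"
    using kq kq' unfolding moved_def by blast+
  show False
  proof (cases "a (Suc i) = k \<or> a (Suc i) = base ?\<xi> k")
    case True
    then have "a j = q \<or> a j = base ?\<xi> q" using pts(2) w(8,9) by auto
    then show False using no_path[OF True _ w(1-7)] by blast
  next
    case False
    then have q: "a (Suc i) = q \<or> a (Suc i) = base ?\<xi> q" using pts(1) by blast
    then have "a j = k \<or> a j = base ?\<xi> k" using pts(2) w(8,9) by auto
    moreover have "fold base (rev w) (a j) = a (Suc i)" using w(1) by (metis fold_base_rev)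
    ultimately show False using no_path[OF _ q, of "a j" "rev w"] w
      by (auto simp: hd_rev last_rev distinct_adj_rev)
  qed
qed

text \<open>Good blocks admit no up arrow into the source of a down arrow. If some crossing arrow
  goes down, the last source of such arrows in the order \<open>before\<close> works, as a down
  arrow into it would start later still. Otherwise all crossing arrows go up, and the first source
  works.\<close>

lemma source_exists:
  assumes "crossing m"
  obtains i k q where "moved (\<Xi> i) k q (a i) (a (Suc i))" "crossing i"
    "\<And>i' k' q'. moved (\<Xi> i') k' q' (a i') (a (Suc i')) \<Longrightarrow> crossing i' \<Longrightarrow> block q' \<noteq> block k"
proof -
  define Sd where "Sd D = {block k | i k q. moved (\<Xi> i) k q (a i) (a (Suc i)) \<and> crossing i \<and> (D \<longrightarrow> before (block q) (block k))}" for D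
  have SdI: "block k \<in> Sd D" if "moved (\<Xi> i) k q (a i) (a (Suc i))" "crossing i" "D \<longrightarrow> before (block q) (block k)"
    for D i k q using that unfolding Sd_def by blast
  have range_a: "range a = a ` {..<l}"
  proof -
    have "a i = a (i mod l)" for i
    proof (induction i rule: less_induct)
      case (less i)
      show ?case
      proof (cases "i < l")
        case False
        then show ?thesis using a_per[of "i - l"] less[of "i - l"] l by (simp add: le_mod_geq)
      qed simp
    qed
    then show ?thesis using l by (auto intro!: image_eqI[of _ a "_ mod l"])
  qed
  have fin: "finite (Sd D)" for D
  proof (rule finite_subset)
    show "Sd D \<subseteq> block ` range a"
    proof
      fix n assume "n \<in> Sd D"
      then obtain i k q where "n = block k" "moved (\<Xi> i) k q (a i) (a (Suc i))" unfolding Sd_def by blast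
      then have "n = block (a i) \<or> n = block (a (Suc i))" using moved_blocks by metis
      then show "n \<in> block ` range a" by blast
    qed
    show "finite (block ` range a)" unfolding range_a by simp
  qed
  have dir: "before (block k) (block q) \<or> before (block q) (block k)"
    if "moved (\<Xi> i) k q (a i) (a (Suc i))" "crossing i" for i k q
    using moved_blocks[OF that(1)] that(2) before_total[of "block k" "block q"] unfolding crossing_def by auto
  have no_up_down: False
    if up: "moved (\<Xi> i) k q (a i) (a (Suc i))" "before (block k) (block q)"
      and down: "moved (\<Xi> i') k' q' (a i') (a (Suc i'))" "before (block q') (block k')"
      and eq: "block q = block k'" for i k q i' k' q'
  proof -
    obtain m where m: "block k' = block (a m)" using moved_blocks[OF down(1)] by metis
    then have "good_block (range \<Xi>) l (block k')" using good by simp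
    moreover have "surg (\<Xi> i) k q" "surg (\<Xi> i') k' q'" using up down by (auto simp: moved_def)
    ultimately show False using up(2) down(2) eq good_block_up_down by blast
  qed
  have asym: "asymp_on X before" "transp_on X before" for X
    by (auto simp: asymp_on_def transp_on_def before_def)
  show ?thesis
  proof (cases "Sd True = {}")
    case False
    then obtain n where n: "n \<in> Sd True" "\<And>x. x \<in> Sd True \<Longrightarrow> \<not> before n x"
      using Finite_Set.bex_max_element[OF fin asym False] before_irrefl by metis
    then obtain i k q where ikq: "n = block k" "moved (\<Xi> i) k q (a i) (a (Suc i))" "crossing i" "before (block q) (block k)"
      unfolding Sd_def by blast
    show ?thesis
    proof (rule that[OF ikq(2,3)])
      fix i' k' q' assume *: "moved (\<Xi> i') k' q' (a i') (a (Suc i'))" "crossing i'"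
      show "block q' \<noteq> block k"
      proof
        assume eq: "block q' = block k"
        show False
        proof (cases "before (block k') (block q')")
          case True
          then show False using no_up_down[OF *(1) True ikq(2,4) eq] by blast
        next
          case False
          then have "before (block q') (block k')" using dir[OF *] by blast
          then have "block k' \<in> Sd True" "before n (block k')" using SdI[OF *] ikq(1) eq by auto
          then show False using n(2) by blast
        qed
      qed
    qed
  next
    case True
    then have up: "before (block k) (block q)" if "moved (\<Xi> i) k q (a i) (a (Suc i))" "crossing i" for i k q
      using dir[OF that] SdI[OF that, of True] True by blast
    have ne: "Sd False \<noteq> {}" using surgicalE[OF crossing_surgical[OF assms]] SdI[of m _ _ False] assms by blast
    then obtain n where n: "n \<in> Sd False" "\<And>x. x \<in> Sd False \<Longrightarrow> \<not> before x n"
      using Finite_Set.bex_min_element[OF fin asym ne] before_irrefl by metis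
    then obtain i k q where ikq: "n = block k" "moved (\<Xi> i) k q (a i) (a (Suc i))" "crossing i"
      unfolding Sd_def by blast
    show ?thesis
    proof (rule that[OF ikq(2,3)])
      fix i' k' q' assume *: "moved (\<Xi> i') k' q' (a i') (a (Suc i'))" "crossing i'"
      then have "block k' \<in> Sd False" "before (block k') (block q')" using up[OF *] SdI[OF *] by auto
      then show "block q' \<noteq> block k" using n(2) ikq(1) by auto
    qed
  qed
qed

text \<open>The walk enters and leaves the source block B only at k or \<open>base \<xi> k\<close>,
  through a single surgery, and makes no surgical step in between. The stretch inside B is thus a
  base path between ends of one base edge, which \<open>segment\<close> excludes.\<close>

lemma crossing_impossible:
  assumes "crossing m"
  shows False
proof -
  obtain i0 k q where kq: "moved (\<Xi> i0) k q (a i0) (a (Suc i0))" and i0: "crossing i0"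
    and src: "\<And>i' k' q'. moved (\<Xi> i') k' q' (a i') (a (Suc i')) \<Longrightarrow> crossing i' \<Longrightarrow> block q' \<noteq> block k"
    using source_exists[OF assms] by metis
  define \<xi> B where "\<xi> = \<Xi> i0" and "B = block k"
  have s: "surg \<xi> k q" using kq by (simp add: moved_def \<xi>_def)
  have neq: "block q \<noteq> B" using src[OF kq i0] by (simp add: B_def)
  \<comment> \<open>No crossing arrow ends in B, so any surgery touching B starts there. Then B
    codes its generator, which identifies the generator and with it the surgery.\<close>
  have touch: "\<Xi> i = \<xi> \<and> moved \<xi> k q (a i) (a (Suc i)) \<and> crossing i"
    if i: "surgical i" "block (a i) = B \<or> block (a (Suc i)) = B" for i
  proof -
    obtain k' q' where kq': "moved (\<Xi> i) k' q' (a i) (a (Suc i))" using i(1) by (rule surgicalE)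
    then have s': "surg (\<Xi> i) k' q'" by (simp add: moved_def)
    have "block k' = B \<or> block q' = B" using moved_blocks[OF kq'] i(2) by auto
    moreover have "block q' = B \<Longrightarrow> block k' = B"
      using src[OF kq'] moved_blocks[OF kq'] unfolding crossing_def B_def by metis
    ultimately have k': "block k' = B" by blast
    obtain m where m: "B = block (a m)" using i(2) by blast
    have X: "\<Xi> i = \<xi>" using codes_unique[of i m i0] surg_codes[OF s] surg_codes[OF s'] k' m
      by (simp add: B_def \<xi>_def)
    have "{block k', block q'} \<inter> {block k, block q} \<noteq> {}" using k' by (simp add: B_def)
    then have eq: "k' = k" "q' = q" using surg_disjoint[OF s'[unfolded X] s] by auto
    have "block (a (Suc i)) \<noteq> block (a i)" using moved_blocks[OF kq'] neq eq unfolding B_def by metis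
    then show ?thesis using kq' X eq by (simp add: crossing_def)
  qed
  have ends: "block (a i0) = B \<or> block (a (Suc i0)) = B" using moved_blocks[OF kq] by (auto simp: B_def)
  \<comment> \<open>A periodic walk that leaves B has to come back.\<close>
  have "\<exists>i. block (a i) \<noteq> B \<and> block (a (Suc i)) = B"
  proof (cases "block (a i0) = B")
    case True
    then have out: "block (a (Suc i0)) \<noteq> B" using i0 by (simp add: crossing_def)
    show ?thesis
    proof (rule ccontr)
      assume "\<not> ?thesis"
      then have "block (a (Suc i0 + d)) \<noteq> B" for d by (induction d) (use out in auto)
      then have "block (a (i0 + l)) \<noteq> B" using l by (metis Suc_pred add_Suc_shift)
      then show False using True a_per by simp
    qed
  next
    case False
    then show ?thesis using ends by blast
  qed
  then obtain i where i: "block (a i) \<noteq> B" "block (a (Suc i)) = B" by blast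
  define P where "P d \<longleftrightarrow> block (a (Suc i + d)) \<noteq> B" for d
  have "P (l - 1)" using i a_per[of i] l unfolding P_def by simp
  then have "P (LEAST d. P d)" "(LEAST d. P d) \<le> l - 1" by (auto intro: LeastI Least_le)
  then obtain d where d: "P d" "d \<le> l - 1" "\<And>m. m < d \<Longrightarrow> \<not> P m" using not_less_Least by metis
  have "d \<noteq> 0" using d(1) i(2) by (metis P_def add_0_right)
  define j where "j = i + d"
  have inB: "block (a m) = B" if "i < m" "m \<le> j" for m
    using d(3)[of "m - Suc i"] that \<open>d \<noteq> 0\<close> by (auto simp: P_def j_def)
  have j: "i < j" "j \<le> i + l" "block (a j) = B" "block (a (Suc j)) \<noteq> B"
    using d \<open>d \<noteq> 0\<close> inB[of j] by (auto simp: P_def j_def)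
  have between: "\<not> surgical m" if "i < m" "m < j" for m
    using touch[of m] inB[of m] inB[of "Suc m"] that by (auto simp: crossing_def)
  have ti: "\<Xi> i = \<xi>" "moved \<xi> k q (a i) (a (Suc i))"
    using touch[of i] i crossing_surgical[of i] by (simp_all add: crossing_def)
  have tj: "\<Xi> j = \<xi>" "moved \<xi> k q (a j) (a (Suc j))"
    using touch[of j] j crossing_surgical[of j] by (simp_all add: crossing_def)
  have "a (Suc i) = k \<or> a (Suc i) = base \<xi> k" "a j = k \<or> a j = base \<xi> k"
    using ti(2) tj(2) i(2) j(3) neq unfolding moved_def by auto
  moreover obtain w where "a j \<noteq> a (Suc i)" "a j \<noteq> base \<xi> (a (Suc i))"
    by (rule segment[OF j(1,2) ti(1) tj(1) between])
  ultimately show False by auto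
qed

lemma impossible: False
  using crossing_impossible no_crossing_impossible by blast

end

section \<open>Maximality\<close>

lemma fold_gen_rev [simp]: "fold gen (rev w) (fold gen w a) = a"
  by (induction w arbitrary: a) auto

lemma fold_gen_rev' [simp]: "fold gen w (fold gen (rev w) a) = a"
  using fold_gen_rev[of "rev w" a] by simp

lemma bij_fold_gen: "bij (fold gen w)"
  by (rule o_bij[of "fold gen (rev w)"]) (auto simp: fun_eq_iff)

text \<open>A word of one letter is not cyclically reduced, so it is treated separately. Its fixed
  points come from surgeries with k = q, and these are finitely many by the case of the empty
  word.\<close>

lemma finite_fixed_gen: "finite {a. gen \<xi> a = a}"
proof -
  have surg: "\<exists>k. surg \<xi> k k \<and> (a = k \<or> a = base \<xi> k)" if "gen \<xi> a = a" for a
  proof -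
    have "\<exists>k q. moved \<xi> k q a a" using gen_cases[of \<xi> a] that base_neq[of \<xi> a] by metis
    then obtain k q where m: "moved \<xi> k q a a" by blast
    then have "k = q" unfolding moved_def by (metis base_base)
    then show ?thesis using m unfolding moved_def by blast
  qed
  show ?thesis
  proof (cases "\<exists>k. surg \<xi> k k")
    case True
    then have "finite {k. \<exists>q. surg \<xi> k q \<and> fold base [] k = q}"
      using surg_stay_finite[of \<xi> _ _ "[]"] by auto
    then have "finite {k. surg \<xi> k k}" by simp
    then have "finite ({k. surg \<xi> k k} \<union> base \<xi> ` {k. surg \<xi> k k})" by simp
    then show ?thesis by (rule finite_subset[rotated]) (use surg in blast)
  next
    case False
    then have "{a. gen \<xi> a = a} = {}" using surg by blast
    then show ?thesis by simp
  qed
qed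

text \<open>With indices taken modulo the length, a fixed point yields a closed walk, which must
  visit one of finitely many bad blocks within a period. Prefixes of the word act injectively, so
  each visit accounts for finitely many fixed points.\<close>

lemma finite_fixed_cyclically_reduced:
  assumes w: "distinct_adj w" "w \<noteq> []" "hd w \<noteq> last w"
  shows "finite {a. fold gen w a = a}"
proof -
  define l where "l = length w"
  define X where "X i = w ! (i mod l)" for i
  have l: "0 < l" using w(2) by (simp add: l_def)
  have range_X: "range X \<subseteq> set w" using l by (auto simp: X_def l_def)
  then have "finite (range X)" using finite_subset by blast
  then obtain N where N: "\<And>n. N \<le> n \<Longrightarrow> good_block (range X) l n"
    using good_block_eventually[of "range X" l] unfolding eventually_sequentially by blast
  have red: "X (Suc i) \<noteq> X i" for i
  proof (cases "Suc (i mod l) = l")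
    case True
    then have "Suc i mod l = 0" "i mod l = l - 1" by (auto simp: mod_Suc)
    then have "X (Suc i) = hd w" "X i = last w" using w(2) by (auto simp: X_def l_def hd_conv_nth last_conv_nth)
    then show ?thesis using w(3) by simp
  next
    case False
    then have "Suc i mod l = Suc (i mod l)" by (simp add: mod_Suc)
    moreover have "Suc (i mod l) < l" using False l mod_less_divisor[of l i] by linarith
    ultimately show ?thesis using w(1) unfolding distinct_adj_conv_nth X_def l_def by (metis)
  qed
  define pre where "pre i a = fold gen (map X [0..<i]) a" for i a
  have w_eq: "map X [0..<l] = w" by (rule nth_equalityI) (auto simp: X_def l_def)
  have "\<exists>i<l. block (pre i a) < N" if fixed: "fold gen w a = a" for a
  proof (rule ccontr)
    assume far: "\<not> (\<exists>i<l. block (pre i a) < N)"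
    have X_per: "X (i + l) = X i" for i by (simp add: X_def)
    have pre_step: "pre (Suc i) a = gen (X i) (pre i a)" for i by (simp add: pre_def)
    have pre_per: "pre (i + l) a = pre i a" for i
      by (induction i) (use fixed in \<open>auto simp: pre_step X_per w_eq pre_def[of l] pre_def[of 0]\<close>)
    have "N \<le> block (pre i a)" for i
    proof (induction i rule: less_induct)
      case (less i)
      show ?case
      proof (cases "i < l")
        case True
        then show ?thesis using far by (meson not_less)
      next
        case False
        then show ?thesis using pre_per[of "i - l"] less[of "i - l"] l by simp
      qed
    qed
    then have "closed_walk (\<lambda>i. pre i a) X l"
      by unfold_locales (use l pre_per X_per pre_step red N in auto)
    then show False by (rule closed_walk.impossible)
  qed
  then have "{a. fold gen w a = a} \<subseteq> (\<Union>i<l. pre i -` {b. block b < N})" by auto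
  moreover have "finite (pre i -` {b. block b < N})" for i
    unfolding pre_def using bij_fold_gen[of "map X [0..<i]"] finite_blocks_less
    by (intro finite_vimageI) (auto simp: bij_def)
  then have "finite (\<Union>i<l. pre i -` {b. block b < N})" by blast
  ultimately show ?thesis by (rule finite_subset)
qed

lemma not_distinct_adj_decomp:
  assumes "\<not> distinct_adj w"
  shows "\<exists>u \<xi> v. w = u @ [\<xi>, \<xi>] @ v"
  using assms
proof (induction w rule: induct_list012)
  case (3 \<xi> \<eta> w)
  show ?case
  proof (cases "\<xi> = \<eta>")
    case True
    then show ?thesis by (metis append_Cons append_Nil)
  next
    case False
    then have "\<not> distinct_adj (\<eta> # w)" using 3(3) by simp
    then obtain u \<zeta> v where "\<eta> # w = u @ [\<zeta>, \<zeta>] @ v" using 3(2) by blast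
    then have "\<xi> # \<eta> # w = (\<xi> # u) @ [\<zeta>, \<zeta>] @ v" by simp
    then show ?thesis by blast
  qed
qed auto

text \<open>Cancelling a repeated letter leaves the value unchanged; stripping a common first and
  last letter conjugates it, which only transports the fixed points.\<close>

lemma fold_gen_id_or_finite: "fold gen w = id \<or> finite {a. fold gen w a = a}"
proof (induction "length w" arbitrary: w rule: less_induct)
  case less
  consider "w = []" | "\<not> distinct_adj w" | \<xi> where "w = [\<xi>]"
    | "distinct_adj w" "w \<noteq> []" "hd w \<noteq> last w" | \<xi> u where "w = \<xi> # u @ [\<xi>]"
    by (metis append_butlast_last_id list.exhaust_sel last.simps)
  then show ?case
  proof cases
    case 1
    then show ?thesis by (simp add: id_def)
  next
    case 2
    then obtain u \<xi> v where w: "w = u @ [\<xi>, \<xi>] @ v" using not_distinct_adj_decomp by blast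
    then have "fold gen w = fold gen (u @ v)" by (simp add: fun_eq_iff)
    then show ?thesis using less[of "u @ v"] w by simp
  next
    case 3
    then show ?thesis using finite_fixed_gen by simp
  next
    case 4
    then show ?thesis using finite_fixed_cyclically_reduced by blast
  next
    case 5
    have eq: "fold gen w a = gen \<xi> (fold gen u (gen \<xi> a))" for a by (simp add: 5)
    have "fold gen u = id \<or> finite {a. fold gen u a = a}" using 5 by (intro less) simp
    then show ?thesis
    proof
      assume "fold gen u = id"
      then show ?thesis by (auto simp: eq fun_eq_iff)
    next
      assume "finite {a. fold gen u a = a}"
      then have "finite (gen \<xi> ` {a. fold gen u a = a})" by simp
      moreover have "{a. fold gen w a = a} \<subseteq> gen \<xi> ` {a. fold gen u a = a}"
      proof
        fix a assume "a \<in> {a. fold gen w a = a}"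
        then have "gen \<xi> (gen \<xi> (fold gen u (gen \<xi> a))) = gen \<xi> a" by (simp add: eq)
        then have "fold gen u (gen \<xi> a) = gen \<xi> a" by simp
        then show "a \<in> gen \<xi> ` {a. fold gen u a = a}" by (intro image_eqI[of a _ "gen \<xi> a"]) auto
      qed
      ultimately show ?thesis using finite_subset by blast
    qed
  qed
qed

definition mcg :: "(nat \<Rightarrow> nat) set" where
  "mcg = range (fold gen)"

lemma Bij_UNIV_iff: "f \<in> Bij UNIV \<longleftrightarrow> bij f"
  by (simp add: Bij_def)

lemma BijGroup_UNIV_mult: "bij f \<Longrightarrow> bij g \<Longrightarrow> f \<otimes>\<^bsub>BijGroup UNIV\<^esub> g = f \<circ> g"
  by (simp add: BijGroup_def Bij_UNIV_iff compose_def fun_eq_iff)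

lemma mcg_subgroup: "subgroup mcg (BijGroup UNIV)"
proof
  show "mcg \<subseteq> carrier (BijGroup UNIV)"
    using bij_fold_gen by (auto simp: mcg_def BijGroup_def Bij_UNIV_iff)
  show "\<one>\<^bsub>BijGroup UNIV\<^esub> \<in> mcg"
    unfolding mcg_def BijGroup_def by (rule range_eqI[of _ _ "[]"]) (simp add: fun_eq_iff)
  fix f g assume "f \<in> mcg" "g \<in> mcg"
  then obtain u v where uv: "f = fold gen u" "g = fold gen v" by (auto simp: mcg_def)
  have "f \<otimes>\<^bsub>BijGroup UNIV\<^esub> g = fold gen (v @ u)"
    using uv by (simp add: BijGroup_UNIV_mult bij_fold_gen)
  then show "f \<otimes>\<^bsub>BijGroup UNIV\<^esub> g \<in> mcg" unfolding mcg_def by (rule range_eqI)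
next
  fix f assume "f \<in> mcg"
  then obtain u where u: "f = fold gen u" by (auto simp: mcg_def)
  have "inv\<^bsub>BijGroup UNIV\<^esub> f = inv_into UNIV f"
    unfolding u using bij_fold_gen by (subst inv_BijGroup) (auto simp: Bij_UNIV_iff)
  also have "inv_into UNIV f = fold gen (rev u)" unfolding u by (rule inv_equality) auto
  finally show "inv\<^bsub>BijGroup UNIV\<^esub> f \<in> mcg" unfolding mcg_def by (rule range_eqI)
qed

lemma mcg_cofinitary: "cofinitary_group mcg"
  unfolding cofinitary_group_def using mcg_subgroup fold_gen_id_or_finite by (auto simp: mcg_def)

section \<open>Counting altered points\<close>

lemma card_touched: "card {a. block a = n \<and> gen \<xi> a \<noteq> base \<xi> a} \<le> 4"
proof (cases "\<exists>a. block a = n \<and> gen \<xi> a \<noteq> base \<xi> a")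
  case True
  then obtain a0 k q where a0: "block a0 = n" "moved \<xi> k q a0 (gen \<xi> a0)" using gen_cases by metis
  have "{a. block a = n \<and> gen \<xi> a \<noteq> base \<xi> a} \<subseteq> {k, q, base \<xi> k, base \<xi> q}"
  proof
    fix a assume "a \<in> {a. block a = n \<and> gen \<xi> a \<noteq> base \<xi> a}"
    then obtain k' q' where a: "block a = n" "moved \<xi> k' q' a (gen \<xi> a)" using gen_cases[of \<xi> a] by auto
    have s: "surg \<xi> k q" "surg \<xi> k' q'" using a0 a by (auto simp: moved_def)
    have "{block k, block q} \<inter> {block k', block q'} \<noteq> {}"
      using moved_blocks[OF a(2)] moved_blocks[OF a0(2)] a(1) a0(1) by auto
    then have "k = k'" "q = q'" using surg_disjoint[OF s] by auto
    then show "a \<in> {k, q, base \<xi> k, base \<xi> q}" using a(2) unfolding moved_def by blast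
  qed
  then have "card {a. block a = n \<and> gen \<xi> a \<noteq> base \<xi> a} \<le> card {k, q, base \<xi> k, base \<xi> q}"
    by (intro card_mono) auto
  also have "\<dots> \<le> 4" by (simp add: card_insert_if)
  finally show ?thesis .
next
  case False
  then have "{a. block a = n \<and> gen \<xi> a \<noteq> base \<xi> a} = {}" by blast
  then show ?thesis by (simp only: card.empty zero_le)
qed

text \<open>Each letter adds at most four points: where the paths first part, the base image lies
  among the points altered by that letter, and base paths are injective.\<close>

lemma card_differ: "card {a. block a = n \<and> fold gen w a \<noteq> fold base w a} \<le> 4 * length w"
proof (induction w rule: rev_induct)
  case (snoc \<xi> w)
  let ?D = "\<lambda>w. {a. block a = n \<and> fold gen w a \<noteq> fold base w a}"
  let ?T = "{a. block a = n \<and> gen \<xi> a \<noteq> base \<xi> a}"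
  have fin: "finite {a. block a = n \<and> P a}" for P
    by (rule finite_subset[OF _ finite_block[of n]]) auto
  have "?D (w @ [\<xi>]) \<subseteq> ?D w \<union> {a. block a = n \<and> fold base w a \<in> ?T}" by auto
  then have "card (?D (w @ [\<xi>])) \<le> card (?D w \<union> {a. block a = n \<and> fold base w a \<in> ?T})"
    by (intro card_mono finite_UnI fin)
  also have "\<dots> \<le> card (?D w) + card {a. block a = n \<and> fold base w a \<in> ?T}" by (rule card_Un_le)
  also have "card {a. block a = n \<and> fold base w a \<in> ?T} \<le> card ?T"
    by (rule card_inj_on_le[of "fold base w"]) (auto simp: inj_on_def fin dest: fold_base_inj)
  also have "\<dots> \<le> 4" by (rule card_touched)
  finally show ?case using snoc by simp
qed simp

lemma popular_point:
  assumes "popular x l E n" "4 * length w \<le> n"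
  obtains k where "block k = n" "fold base (letters E l) k = x k" "fold gen w k = fold base w k"
proof -
  let ?A = "{k. block k = n \<and> fold base (letters E l) k = x k}"
  let ?D = "{k. block k = n \<and> fold gen w k \<noteq> fold base w k}"
  have "card ?D < card ?A" using assms card_differ[of n w] unfolding popular_def by simp
  moreover have "finite ?D" by (rule finite_subset[OF _ finite_block[of n]]) auto
  ultimately have "\<not> ?A \<subseteq> ?D" using card_mono[of ?D ?A] by linarith
  then obtain k where "k \<in> ?A" "k \<notin> ?D" by blast
  then show ?thesis using that[of k] by auto
qed

lemma popular_infinite_agree:
  assumes "infinite {n. popular x l E n}"
  shows "infinite {a. x a = fold gen (letters E l) a}"
proof
  assume "finite {a. x a = fold gen (letters E l) a}"
  then have "finite (block ` {a. x a = fold gen (letters E l) a})" by simp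
  moreover have "{n. popular x l E n} - {..<4 * l} \<subseteq> block ` {a. x a = fold gen (letters E l) a}"
  proof
    fix n assume "n \<in> {n. popular x l E n} - {..<4 * l}"
    then obtain k where "block k = n" "fold gen (letters E l) k = x k"
      using popular_point[of x l E n "letters E l"] by auto
    then show "n \<in> block ` {a. x a = fold gen (letters E l) a}" by force
  qed
  ultimately have "finite ({n. popular x l E n} - {..<4 * l})" using finite_subset by blast
  then show False using assms by simp
qed


lemma perm_of_graph_set [simp]: "perm_of (graph_set x) = x"
proof
  fix i
  have "prod_encode (i, j) \<in> graph_set x \<longleftrightarrow> j = x i" for j
    by (auto simp: graph_set_def prod_encode_eq)
  then show "perm_of (graph_set x) i = x i" unfolding perm_of_def by (intro Least_equality) auto
qed

lemma is_perm_graph_set: "bij x \<Longrightarrow> is_perm (graph_set x)"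
  by (simp add: is_perm_def)

lemma not_admissibleD:
  assumes "\<not> admissible \<xi> (prod_encode (s, prod_encode (i, l)))"
  obtains t b where "\<And>k. b < block k \<Longrightarrow> \<not> cand \<xi> (perm_of \<xi>) s i l t k"
  using assms unfolding admissible_def cand_mode_def by auto

text \<open>Pigeonhole: block \<open>n\<close> has more than \<open>n\<close> times as many points as there are words of length at most \<open>n\<close>.\<close>

lemma popular_exists:
  assumes "t \<le> n"
    and "\<And>k. block k = n \<Longrightarrow> \<exists>l z. l \<le> t \<and> reduced_at n (set_decode z) l \<and> fold base (letters (set_decode z) l) k = x k"
  obtains l z where "l \<le> t" "popular x l (set_decode z) n"
proof -
  obtain L Z where LZ: "\<And>k. block k = n \<Longrightarrow> L k \<le> t \<and> reduced_at n (set_decode (Z k)) (L k) \<and>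
      fold base (letters (set_decode (Z k)) (L k)) k = x k"
    using assms(2) by metis
  define h where "h k = map (\<lambda>\<xi>. trunc \<xi> n) (letters (set_decode (Z k)) (L k))" for k
  define I where "I = {k. block k = n}"
  define W where "W = {w :: nat list. set w \<subseteq> {..<2 ^ n} \<and> length w \<le> t}"
  have h_len: "length (h k) = L k" for k by (simp add: h_def)
  have finW: "finite W" unfolding W_def by (rule finite_lists_length_le) simp
  have hW: "h k \<in> W" if "k \<in> I" for k
  proof -
    have "set (h k) \<subseteq> {..<2 ^ n}" using trunc_less by (auto simp: h_def)
    then show ?thesis using LZ[of k] that by (simp add: W_def I_def h_len)
  qed
  have finI: "finite I" by (simp add: I_def finite_block)
  \<comment> \<open>In block n the letters are numbers below 2 ^ n and the length is at most t,
    hence at most n. Multiplied by n, this count is below \<open>base_size n\<close>.\<close>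
  have "card W = (\<Sum>i\<le>t. (2 ^ n) ^ i)" unfolding W_def by (simp add: card_lists_length_le)
  also have "\<dots> \<le> (\<Sum>i\<le>t. 2 ^ (n * n))"
    using assms(1) by (intro sum_mono) (simp add: power_mult[symmetric])
  also have "\<dots> \<le> (n + 1) * 2 ^ (n * n)" using assms(1) by simp
  finally have "card W \<le> (n + 1) * 2 ^ (n * n)" .
  then have "n * card W \<le> n * ((n + 1) * 2 ^ (n * n))" by (rule mult_le_mono2)
  then have cardW: "card W * n \<le> n * (n + 1) * 2 ^ (n * n)" by (simp only: mult.assoc mult.commute[of n "card W"])
  have "\<exists>w\<in>W. n < card {k \<in> I. h k = w}"
  proof (rule ccontr)
    assume "\<not> ?thesis"
    then have le: "card {k \<in> I. h k = w} \<le> n" if "w \<in> W" for w using that by (simp add: not_less)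
    have "I = (\<Union>w\<in>W. {k \<in> I. h k = w})" using hW by blast
    then have "card I \<le> (\<Sum>w\<in>W. card {k \<in> I. h k = w})" using card_UN_le[OF finW] by metis
    also have "\<dots> \<le> card W * n" using sum_bounded_above[of W _ n] le by simp
    also have "\<dots> < card I" using cardW base_size_gt[of n] by (simp add: I_def card_block)
    finally show False by simp
  qed
  then obtain w where w: "n < card {k \<in> I. h k = w}" by blast
  then obtain k where k: "k \<in> I" "h k = w" by (metis (mono_tags, lifting) card.empty empty_Collect_eq not_less_zero)
  then have bk: "block k = n" by (simp add: I_def)
  let ?E = "set_decode (Z k)"
  have "{k' \<in> I. h k' = w} \<subseteq> {k'. block k' = n \<and> fold base (letters ?E (L k)) k' = x k'}"
  proof
    fix k' assume "k' \<in> {k' \<in> I. h k' = w}"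
    then have k': "block k' = n" "h k' = h k" using k by (auto simp: I_def)
    have "fold base (letters ?E (L k)) k' = fold base (letters (set_decode (Z k')) (L k')) k'"
      using k' by (intro fold_base_cong) (simp add: h_def)
    then show "k' \<in> {k'. block k' = n \<and> fold base (letters ?E (L k)) k' = x k'}" using LZ[OF k'(1)] k'(1) by simp
  qed
  then have "card {k' \<in> I. h k' = w} \<le> card {k'. block k' = n \<and> fold base (letters ?E (L k)) k' = x k'}"
    by (intro card_mono finite_subset[OF _ finite_block[of n]]) auto
  then have "popular x (L k) ?E n" using w LZ[OF bk] by (simp add: popular_def)
  then show ?thesis using that LZ[OF bk] by blast
qed

text \<open>Failure of the first two kinds keeps x inside almost all blocks coded by \<xi> in one
  colour. Failure of the third joins each point there to its image by a word of bounded length, so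
  some length l has popular words in infinitely many of these blocks. Failure of the fourth makes
  their limit popular infinitely often.\<close>

lemma not_admissible_popular:
  assumes na: "\<And>p. \<not> admissible \<xi> p"
  obtains l W where "infinite {n. popular (perm_of \<xi>) l W n}"
proof -
  let ?x = "perm_of \<xi>"
  \<comment> \<open>The stage at which the downward kind fails is reused as the colour i for the
    other kinds; in that colour almost no arrow from a block coded by \<xi> goes down.\<close>
  obtain i b1 where down: "\<And>k. b1 < block k \<Longrightarrow> \<not> cand \<xi> ?x 1 0 0 i k" using not_admissibleD[OF na] by metis
  obtain t0 b0 where up: "\<And>k. b0 < block k \<Longrightarrow> \<not> cand \<xi> ?x 0 i 0 t0 k" using not_admissibleD[OF na] by metis
  obtain t2 b2 where far: "\<And>k. b2 < block k \<Longrightarrow> \<not> cand \<xi> ?x 2 i 0 t2 k" using not_admissibleD[OF na] by metis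
  define A where "A = coloured_codes \<xi> i"
  have stay: "block (?x k) = block k" if "max b0 b1 < block k" "block k \<in> A" for k
    using down[of k] up[of k] before_total[of "block k" "block (?x k)"] that
    by (auto simp: cand_def cand_up_def cand_down_def A_def coloured_codes_def)
  have ex: "\<exists>l\<in>{..t2}. \<exists>z. popular ?x l (set_decode z) n"
    if n: "max (max b0 b1) (max b2 t2) < n" "n \<in> A" for n
  proof -
    have "\<exists>l z. l \<le> t2 \<and> reduced_at n (set_decode z) l \<and> fold base (letters (set_decode z) l) k = ?x k"
      if "block k = n" for k
      using far[of k] stay[of k] n that by (auto simp: cand_def cand_far_def A_def coloured_codes_def)
    then show ?thesis using popular_exists[of t2 n ?x] n(1) by (metis atMost_iff less_imp_le max_less_iff_conj)
  qed
  have "infinite (A - {..max (max b0 b1) (max b2 t2)})" using coloured_codes_infinite by (simp add: A_def)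
  moreover have "A - {..max (max b0 b1) (max b2 t2)} \<subseteq> (\<Union>l\<le>t2. {n \<in> A. \<exists>z. popular ?x l (set_decode z) n})"
  proof
    fix n assume "n \<in> A - {..max (max b0 b1) (max b2 t2)}"
    then have n: "max (max b0 b1) (max b2 t2) < n" "n \<in> A" by auto
    then show "n \<in> (\<Union>l\<le>t2. {n \<in> A. \<exists>z. popular ?x l (set_decode z) n})" using ex[OF n] n(2) by simp
  qed
  ultimately have "infinite (\<Union>l\<le>t2. {n \<in> A. \<exists>z. popular ?x l (set_decode z) n})" using finite_subset by blast
  then obtain l where inf: "infinite {n \<in> A. \<exists>z. popular ?x l (set_decode z) n}" by blast
  obtain t b3 where near: "\<And>k. b3 < block k \<Longrightarrow> \<not> cand \<xi> ?x 3 i l t k" using not_admissibleD[OF na] by metis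
  define W where "W = word_limit ?x A l"
  let ?E = "\<lambda>n. set_decode (popular_code ?x l n)"
  let ?S = "{n \<in> {n \<in> A. \<exists>z. popular ?x l (set_decode z) n}. trunc (?E n) t = trunc W t}"
  have "infinite ?S" unfolding W_def word_limit_def by (rule limit_set_accum[OF inf])
  then have "infinite (?S - {..max b3 (max b0 b1)})" by simp
  moreover have "?S - {..max b3 (max b0 b1)} \<subseteq> {n. popular ?x l W n}"
  proof
    fix n assume n: "n \<in> ?S - {..max b3 (max b0 b1)}"
    then have pop: "popular ?x l (?E n) n" unfolding popular_code_def by (auto intro: LeastI)
    then have "{k. block k = n \<and> fold base (letters (?E n) l) k = ?x k} \<noteq> {}"
      unfolding popular_def by (metis card.empty not_less_zero)
    then obtain k where k: "block k = n" "fold base (letters (?E n) l) k = ?x k" by blast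
    have "block (?x k) = block k" using k(2) by (metis block_fold_base)
    then show "n \<in> {n. popular ?x l W n}"
      using near[of k] n k pop by (auto simp: cand_def cand_near_def A_def W_def coloured_codes_def)
  qed
  ultimately have "infinite {n. popular ?x l W n}" using finite_subset by blast
  then show ?thesis by (rule that)
qed

lemma agrees_infinitely_often:
  assumes "bij x"
  obtains w where "infinite {a. x a = fold gen w a}"
proof -
  let ?\<xi> = "graph_set x"
  show ?thesis
  proof (cases "\<exists>p. admissible ?\<xi> p")
    case True
    then obtain p where p: "admissible ?\<xi> p" by blast
    have "infinite {k. surg ?\<xi> k (perm_of ?\<xi> k)}" by (rule surg_infinite[OF is_perm_graph_set[OF assms] p])
    moreover have "{k. surg ?\<xi> k (perm_of ?\<xi> k)} \<subseteq> {a. x a = fold gen [?\<xi>] a}"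
    proof
      fix k assume "k \<in> {k. surg ?\<xi> k (perm_of ?\<xi> k)}"
      then have "moved ?\<xi> k (x k) k (x k)" by (simp add: moved_def)
      then show "k \<in> {a. x a = fold gen [?\<xi>] a}" using gen_moved by simp
    qed
    ultimately have "infinite {a. x a = fold gen [?\<xi>] a}" using finite_subset by blast
    then show ?thesis by (rule that)
  next
    case False
    then obtain l W where "infinite {n. popular (perm_of ?\<xi>) l W n}"
      by (metis not_admissible_popular)
    then have "infinite {n. popular x l W n}" by simp
    then show ?thesis using popular_infinite_agree that by blast
  qed
qed

lemma mcg_maximal: "maximal_cofinitary_group mcg"
  unfolding maximal_cofinitary_group_def
proof (intro conjI notI)
  show "cofinitary_group mcg" by (rule mcg_cofinitary)
  assume "\<exists>H. cofinitary_group H \<and> mcg \<subset> H"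
  then obtain H x where H: "cofinitary_group H" "mcg \<subseteq> H" and x: "x \<in> H" "x \<notin> mcg" by blast
  have sub: "subgroup H (BijGroup UNIV)" using H(1) by (simp add: cofinitary_group_def)
  then have "x \<in> carrier (BijGroup UNIV)" using x(1) subgroup.subset by blast
  then have bij: "bij x" by (simp add: BijGroup_def Bij_UNIV_iff)
  then obtain w where w: "infinite {a. x a = fold gen w a}" by (rule agrees_infinitely_often)
  let ?g = "fold gen (rev w)"
  have "?g \<in> H" using H(2) by (auto simp: mcg_def)
  then have "?g \<otimes>\<^bsub>BijGroup UNIV\<^esub> x \<in> H" using subgroup.m_closed[OF sub] x(1) by blast
  then have gx: "?g \<circ> x \<in> H" using bij by (simp add: BijGroup_UNIV_mult bij_fold_gen)
  have "{a. x a = fold gen w a} \<subseteq> {a. (?g \<circ> x) a = a}" by auto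
  then have "infinite {a. (?g \<circ> x) a = a}" using w finite_subset by blast
  then have "?g \<circ> x = id" using H(1) gx unfolding cofinitary_group_def by blast
  then have "?g (x a) = a" for a by (metis comp_apply id_apply)
  then have "x a = fold gen w a" for a by (metis fold_gen_rev')
  then have "x = fold gen w" by blast
  then show False using x(2) by (auto simp: mcg_def)
qed


section \<open>Recovering a reduced word from its value\<close>

lemma reduced_word_exists: "\<exists>v. distinct_adj v \<and> fold gen v = fold gen w"
proof (induction "length w" arbitrary: w rule: less_induct)
  case less
  show ?case
  proof (cases "distinct_adj w")
    case False
    then obtain u \<xi> v where w: "w = u @ [\<xi>, \<xi>] @ v" using not_distinct_adj_decomp by blast
    then have "fold gen w = fold gen (u @ v)" by (simp add: fun_eq_iff)
    then show ?thesis using less[of "u @ v"] w by simp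
  qed blast
qed

text \<open>On large blocks, a reduced word in the generators is the only word of its length that agrees with its
  own value at many points; so its letters can be recovered arithmetically from that value.\<close>

lemma word_limit_fold_gen:
  assumes w: "distinct_adj w"
  shows "letters (word_limit (fold gen w) UNIV (length w)) (length w) = w"
proof -
  let ?f = "fold gen w" and ?l = "length w"
  let ?E = "\<lambda>n. set_decode (popular_code ?f ?l n)"
  obtain N0 where N0: "\<And>n. N0 \<le> n \<Longrightarrow> distinct_adj (map (\<lambda>\<xi>. trunc \<xi> n) w)"
    using distinct_adj_eventually_trunc[OF w] by blast
  define N where "N = max N0 (Suc (4 * ?l))"
  have ex: "\<exists>z. popular ?f ?l (set_decode z) n" if n: "N \<le> n" for n
  proof -
    obtain z where z: "map (\<lambda>\<xi>. trunc \<xi> n) (letters (set_decode z) ?l) = map (\<lambda>\<xi>. trunc \<xi> n) w"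
      using code_of_word by blast
    let ?A = "{k. block k = n \<and> fold base (letters (set_decode z) ?l) k = ?f k}"
    let ?D = "{k. block k = n \<and> fold gen w k \<noteq> fold base w k}"
    have "fold base (letters (set_decode z) ?l) k = fold base w k" if "block k = n" for k
      using z that by (intro fold_base_cong) simp
    then have "{k. block k = n} \<subseteq> ?A \<union> ?D" by auto
    moreover have "finite (?A \<union> ?D)" by (rule finite_subset[OF _ finite_block[of n]]) auto
    ultimately have "card {k. block k = n} \<le> card (?A \<union> ?D)" by (intro card_mono)
    then have "base_size n \<le> card (?A \<union> ?D)" by (simp only: card_block)
    also have "\<dots> \<le> card ?A + 4 * ?l" using card_Un_le[of ?A ?D] card_differ[of n w] by linarith
    finally have "base_size n \<le> card ?A + 4 * ?l" .
    \<comment> \<open>More than n + 4 * \<open>length w\<close> points are required in the block;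
      since 4 * \<open>length w\<close> < n, having more than 2 * n is enough.\<close>
    moreover have "n * 2 \<le> n * (n + 1) * 2 ^ (n * n)"
    proof -
      have "n * 2 * 1 \<le> n * (n + 1) * 2 ^ (n * n)"
        using n by (intro mult_le_mono) (auto simp: N_def)
      then show ?thesis by simp
    qed
    ultimately have "n < card ?A" using base_size_gt[of n] n by (simp add: N_def)
    then have "popular ?f ?l (set_decode z) n"
      using z N0[of n] n by (simp add: popular_def reduced_at_iff N_def)
    then show ?thesis by blast
  qed
  have eq: "map (\<lambda>\<xi>. trunc \<xi> n) (letters (?E n) ?l) = map (\<lambda>\<xi>. trunc \<xi> n) w" if n: "N \<le> n" for n
  proof -
    have pop: "popular ?f ?l (?E n) n" using ex[OF n] unfolding popular_code_def by (rule LeastI_ex)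
    have "4 * ?l \<le> n" using n by (simp add: N_def)
    then obtain k where k: "block k = n" "fold base (letters (?E n) ?l) k = ?f k" "fold gen w k = fold base w k"
      by (rule popular_point[OF pop])
    have "map (\<lambda>\<xi>. trunc \<xi> (block k)) (letters (?E n) ?l) = map (\<lambda>\<xi>. trunc \<xi> (block k)) w"
    proof (rule base_path_unique)
      show "fold base (letters (?E n) ?l) k = fold base w k" using k by simp
      show "length (letters (?E n) ?l) + length w \<le> block k" using n k(1) by (simp add: N_def)
      show "distinct_adj (map (\<lambda>\<xi>. trunc \<xi> (block k)) (letters (?E n) ?l))"
        using pop k(1) unfolding popular_def reduced_at_iff by simp
      show "distinct_adj (map (\<lambda>\<xi>. trunc \<xi> (block k)) w)" using N0[of n] n k(1) by (simp add: N_def)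
    qed
    then show ?thesis using k(1) by simp
  qed
  let ?A = "{n \<in> UNIV. \<exists>z. popular ?f ?l (set_decode z) n}"
  have "{N..} \<subseteq> ?A" using ex by auto
  then have inf: "infinite ?A" using infinite_Ici finite_subset by blast
  let ?W = "word_limit ?f UNIV ?l"
  have "\<exists>n. max t N \<le> n \<and> trunc (?E n) t = trunc ?W t" for t
  proof -
    have "infinite {n \<in> ?A. trunc (?E n) t = trunc ?W t}"
      unfolding word_limit_def by (rule limit_set_accum[OF inf])
    then obtain n where "max t N < n" "n \<in> {n \<in> ?A. trunc (?E n) t = trunc ?W t}"
      unfolding infinite_nat_iff_unbounded by blast
    then show ?thesis by (intro exI[of _ n]) auto
  qed
  then obtain n where n: "\<And>t. max t N \<le> n t" "\<And>t. trunc (?E (n t)) t = trunc ?W t" by metis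
  show ?thesis
  proof (rule limit_letters[of UNIV n "\<lambda>t. ?E (n t)"])
    fix t
    show "t \<le> n t" using n(1)[of t] by simp
    show "map (\<lambda>\<xi>. trunc \<xi> (n t)) (letters (?E (n t)) ?l) = map (\<lambda>\<xi>. trunc \<xi> (n t)) w"
      using n(1)[of t] by (intro eq) simp
    show "trunc (?E (n t)) t = trunc ?W t" by (rule n(2))
  qed simp
qed

text \<open>The quantifier over words of sets becomes one over their lengths, since the letters are
  computed from f. Conversely, whatever the limit is, the equation exhibits f as a value of a
  word.\<close>

lemma mcg_eq: "mcg = {f. \<exists>l. \<forall>a. f a = fold gen (letters (word_limit f UNIV l) l) a}"
proof (intro equalityI subsetI)
  fix f assume "f \<in> mcg"
  then obtain w where "distinct_adj w" "f = fold gen w" using reduced_word_exists unfolding mcg_def by (metis imageE)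
  then have "\<forall>a. f a = fold gen (letters (word_limit f UNIV (length w)) (length w)) a"
    using word_limit_fold_gen by simp
  then show "f \<in> {f. \<exists>l. \<forall>a. f a = fold gen (letters (word_limit f UNIV l) l) a}" by blast
next
  fix f assume "f \<in> {f. \<exists>l. \<forall>a. f a = fold gen (letters (word_limit f UNIV l) l) a}"
  then obtain l where "\<forall>a. f a = fold gen (letters (word_limit f UNIV l) l) a" by blast
  then have "f = fold gen (letters (word_limit f UNIV l) l)" by blast
  then show "f \<in> mcg" unfolding mcg_def by (rule range_eqI)
qed

section \<open>Definability\<close>

lemma tarith_pow2 [arith_intros]: "tarith T \<Longrightarrow> tarith (\<lambda>f e. 2 ^ T f e)"
proof (rule tarith_fun1[of "\<lambda>n. 2 ^ n"])
  have *: "2 ^ n = rec_nat 1 (\<lambda>_ y. 2 * y) n" for n :: nat by (induction n) auto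
  show "tarith (\<lambda>f e. 2 ^ e 0)" unfolding * by (intro arith_intros)
qed

lemma sarith_set_decode [arith_intros]:
  assumes "tarith T"
  shows "sarith (\<lambda>f e. set_decode (T f e))"
proof -
  have *: "set_decode z = {c. (z div 2 ^ c) mod 2 = 1}" for z by (auto simp: set_decode_def odd_iff_mod_2_eq_one)
  show ?thesis unfolding * by (intro sarith_Collect arith_intros tarith_ren[OF assms])
qed

declare arith_mem [arith_intros]

lemma tarith_trunc [arith_intros]:
  assumes "sarith X" "tarith T"
  shows "tarith (\<lambda>f e. trunc (X f e) (T f e))"
proof -
  have *: "trunc \<xi> n = (LEAST z. \<forall>i. i \<in> set_decode z \<longleftrightarrow> i \<in> \<xi> \<and> i < n)" for \<xi> n
  proof (rule Least_equality[symmetric])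
    show "\<forall>i. i \<in> set_decode (trunc \<xi> n) \<longleftrightarrow> i \<in> \<xi> \<and> i < n" by (simp add: trunc_def)
    fix z assume "\<forall>i. i \<in> set_decode z \<longleftrightarrow> i \<in> \<xi> \<and> i < n"
    then have "set_decode z = \<xi> \<inter> {..<n}" by auto
    then have "z = trunc \<xi> n" unfolding trunc_def by (metis set_decode_inverse)
    then show "trunc \<xi> n \<le> z" by simp
  qed
  show ?thesis unfolding * by (intro arith_intros sarith_ren[OF assms(1)] tarith_ren[OF assms(2)])
qed

lemma tarith_base_code [arith_intros]: "tarith T \<Longrightarrow> tarith (\<lambda>f e. base_code (T f e))"
  by (rule tarith_fun1[of base_code]) (unfold base_code_def base_ok_def, intro arith_intros)

lemma tarith_base_size [arith_intros]: "tarith T \<Longrightarrow> tarith (\<lambda>f e. base_size (T f e))"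
  unfolding base_size_def by (intro arith_intros)

lemma tarith_base_act [arith_intros]:
  "tarith T \<Longrightarrow> tarith S \<Longrightarrow> tarith A \<Longrightarrow> tarith (\<lambda>f e. base_act (T f e) (S f e) (A f e))"
  unfolding base_act_def by (intro arith_intros)

lemma tarith_offset [arith_intros]: "tarith T \<Longrightarrow> tarith (\<lambda>f e. offset (T f e))"
  unfolding offset_def by (intro arith_intros)

lemma tarith_block [arith_intros]: "tarith T \<Longrightarrow> tarith (\<lambda>f e. block (T f e))"
  by (rule tarith_fun1[of block]) (unfold block_def, intro arith_intros)

lemma tarith_base [arith_intros]:
  "sarith X \<Longrightarrow> tarith T \<Longrightarrow> tarith (\<lambda>f e. base (X f e) (T f e))"
  unfolding base_def by (intro arith_intros)

lemma sarith_sect [arith_intros]: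
  assumes "sarith X" "tarith T"
  shows "sarith (\<lambda>f e. sect (X f e) (T f e))"
  unfolding sect_def by (intro sarith_Collect arith_intros sarith_ren[OF assms(1)] tarith_ren[OF assms(2)])

lemma tarith_fold_base [arith_intros]:
  assumes "sarith X" "tarith L" "tarith A"
  shows "tarith (\<lambda>f e. fold base (letters (X f e) (L f e)) (A f e))"
  unfolding letters_def fold_map_upt_eq_rec_nat
  by (intro arith_intros sarith_ren[OF assms(1)] tarith_ren[OF assms(2)] tarith_ren[OF assms(3)])

lemma arith_reduced_at [arith_intros]:
  assumes "tarith N" "sarith X" "tarith L"
  shows "arith (\<lambda>f e. reduced_at (N f e) (X f e) (L f e))"
  unfolding reduced_at_def
  by (intro arith_intros sarith_ren[OF assms(2)] tarith_ren[OF assms(1)] tarith_ren[OF assms(3)])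

text \<open>Counting below a bound is primitive recursive; for the points of block n the bound is
  \<open>offset (Suc n)\<close>.\<close>

lemma card_eq_rec_nat:
  assumes "\<And>k. P k \<Longrightarrow> k < B"
  shows "card {k. P k} = rec_nat 0 (\<lambda>k c. if P k then Suc c else c) B"
proof -
  have "card {k. k < b \<and> P k} = rec_nat 0 (\<lambda>k c. if P k then Suc c else c) b" for b
  proof (induction b)
    case (Suc b)
    have "{k. k < Suc b \<and> P k} = (if P b then insert b {k. k < b \<and> P k} else {k. k < b \<and> P k})"
      by (auto simp: less_Suc_eq)
    then show ?case using Suc by simp
  qed simp
  moreover have "{k. P k} = {k. k < B \<and> P k}" using assms by auto
  ultimately show ?thesis by simp
qed

lemma arith_popular [arith_intros]:
  assumes x: "farith x" and L: "tarith L" and X: "sarith X" and N: "tarith N"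
  shows "arith (\<lambda>f e. popular (x f e) (L f e) (X f e) (N f e))"
proof -
  have *: "card {k. block k = n \<and> Q k} = rec_nat 0 (\<lambda>k c. if block k = n \<and> Q k then Suc c else c) (offset (Suc n))"
    for n Q by (rule card_eq_rec_nat) (auto simp: block_eq_iff)
  show ?thesis unfolding popular_def *
    by (intro arith_intros tarith_app[OF farith_ren[OF x]] sarith_ren[OF X] tarith_ren[OF L] tarith_ren[OF N])
qed

lemma tarith_popular_code [arith_intros]:
  assumes x: "farith x" and L: "tarith L" and N: "tarith N"
  shows "tarith (\<lambda>f e. popular_code (x f e) (L f e) (N f e))"
  unfolding popular_code_def
  by (intro arith_intros farith_ren[OF x] tarith_ren[OF L] tarith_ren[OF N])

text \<open>Boundedness expresses finiteness with number quantifiers only, as the leftmost limit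
  requires.\<close>

lemma finite_nat_iff: "finite A \<longleftrightarrow> (\<exists>m. \<forall>n. n \<in> A \<longrightarrow> n \<le> m)" for A :: "nat set"
  by (auto simp: finite_nat_set_iff_bounded_le)

lemma sarith_word_limit [arith_intros]:
  assumes x: "farith x" and A: "sarith A" and L: "tarith L"
  shows "sarith (\<lambda>f e. word_limit (x f e) (A f e) (L f e))"
  unfolding word_limit_def limit_set_def limit_code_def finite_nat_iff mem_Collect_eq
  by (intro sarith_Collect arith_intros farith_ren[OF x] sarith_ren[OF A] tarith_ren[OF L])

lemma arith_codes [arith_intros]:
  assumes "sarith X" "tarith T"
  shows "arith (\<lambda>f e. codes (X f e) (T f e))"
  unfolding codes_def node_def by (intro arith_intros sarith_ren[OF assms(1)] tarith_ren[OF assms(2)])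

lemma tarith_colour [arith_intros]: "tarith T \<Longrightarrow> tarith (\<lambda>f e. colour (T f e))"
  unfolding colour_def by (intro arith_intros)

lemma arith_before [arith_intros]: "tarith S \<Longrightarrow> tarith T \<Longrightarrow> arith (\<lambda>f e. before (S f e) (T f e))"
  unfolding before_def by (intro arith_intros)

lemma sarith_coloured_codes [arith_intros]:
  assumes "sarith X" "tarith T"
  shows "sarith (\<lambda>f e. coloured_codes (X f e) (T f e))"
  unfolding coloured_codes_def by (intro sarith_Collect arith_intros sarith_ren[OF assms(1)] tarith_ren[OF assms(2)])

lemma tarith_perm_of [arith_intros]:
  assumes "sarith X" "tarith T"
  shows "tarith (\<lambda>f e. perm_of (X f e) (T f e))"
  unfolding perm_of_def by (intro arith_intros sarith_ren[OF assms(1)] tarith_ren[OF assms(2)])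

lemma farith_perm_of [arith_intros]:
  assumes "sarith X"
  shows "farith (\<lambda>f e. perm_of (X f e))"
  unfolding farith_def by (intro arith_intros sarith_ren[OF assms])

lemma arith_is_perm [arith_intros]:
  assumes "sarith X"
  shows "arith (\<lambda>f e. is_perm (X f e))"
proof -
  have *: "is_perm \<xi> \<longleftrightarrow> (\<forall>a b. perm_of \<xi> a = perm_of \<xi> b \<longrightarrow> a = b) \<and> (\<forall>b. \<exists>a. b = perm_of \<xi> a) \<and>
     (\<forall>c. c \<in> \<xi> \<longleftrightarrow> (\<exists>i. c = prod_encode (i, perm_of \<xi> i)))" for \<xi>
    unfolding is_perm_def bij_def inj_def surj_def graph_set_def by auto
  show ?thesis unfolding * by (intro arith_intros sarith_ren[OF assms])
qed

lemma arith_cand: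
  assumes "sarith X" "tarith S" "tarith I" "tarith L" "tarith T" "tarith K"
  shows "arith (\<lambda>f e. cand (X f e) (perm_of (X f e)) (S f e) (I f e) (L f e) (T f e) (K f e))"
  unfolding cand_def cand_up_def cand_down_def cand_far_def cand_near_def
  by (intro arith_intros sarith_ren[OF assms(1)] tarith_ren[OF assms(2)] tarith_ren[OF assms(3)]
      tarith_ren[OF assms(4)] tarith_ren[OF assms(5)] tarith_ren[OF assms(6)])

lemma arith_cand_mode [arith_intros]:
  assumes "sarith X" "tarith P" "tarith T" "tarith K"
  shows "arith (\<lambda>f e. cand_mode (X f e) (P f e) (T f e) (K f e))"
  unfolding cand_mode_def by (intro arith_cand arith_intros assms)

lemma arith_admissible [arith_intros]:
  assumes "sarith X" "tarith P"
  shows "arith (\<lambda>f e. admissible (X f e) (P f e))"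
  unfolding admissible_def by (intro arith_intros sarith_ren[OF assms(1)] tarith_ren[OF assms(2)])

lemma tarith_mode [arith_intros]:
  assumes "sarith X"
  shows "tarith (\<lambda>f e. mode (X f e))"
  unfolding mode_def by (intro arith_intros sarith_ren[OF assms])

lemma tarith_sel [arith_intros]:
  assumes "sarith X" "tarith T"
  shows "tarith (\<lambda>f e. sel (X f e) (T f e))"
  unfolding sel_def by (intro arith_intros sarith_ren[OF assms(1)] tarith_ren[OF assms(2)])

lemma arith_surg [arith_intros]:
  assumes "sarith X" "tarith K" "tarith Q"
  shows "arith (\<lambda>f e. surg (X f e) (K f e) (Q f e))"
  unfolding surg_def
  by (intro arith_intros sarith_ren[OF assms(1)] tarith_ren[OF assms(2)] tarith_ren[OF assms(3)])

lemma tarith_gen [arith_intros]: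
  assumes "sarith X" "tarith T"
  shows "tarith (\<lambda>f e. gen (X f e) (T f e))"
  unfolding gen_def moved_def by (intro arith_intros sarith_ren[OF assms(1)] tarith_ren[OF assms(2)])

text \<open>The tested f enters only as an oracle: it supplies both the values to be compared and
  the letters of the word.\<close>

lemma arith_mcg: "arith (\<lambda>f e. f \<in> mcg)"
proof -
  have *: "f \<in> mcg \<longleftrightarrow> (\<exists>l. \<forall>a. f a = rec_nat a (\<lambda>i. gen (sect (word_limit f UNIV l) i)) l)" for f
    unfolding letters_def fold_map_upt_eq_rec_nat[symmetric] by (subst mcg_eq) (simp add: letters_def)
  show ?thesis unfolding * by (intro arith_intros farith_oracle sarith_UNIV)
qed

theorem theorem2p2:
  shows "\<exists>G :: (nat \<Rightarrow> nat) set. maximal_cofinitary_group G \<and>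
           (\<exists>n. Sigma0_definable n G) \<and> G \<in> sets borel"
  using mcg_maximal arith_imp_definable[OF arith_mcg] by auto

end
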